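(* Multiplication on $\mathbb{N}$ is existentially first-order definable in the structure $\langle \mathbb{N}, +, n \mapsto p_n, n \mapsto r_n\rangle$; that is, there is an existential first-order formula $\varphi(x,y,z)$ in the language (with equality) consisting of a binary function symbol for $+$ and two unary function symbols for $n \mapsto p_n$ and $n \mapsto r_n$, such that for all $x,y,z \in \mathbb{N}$, $\varphi(x,y,z)$ holds in this structure if and only if $z = xy$.
   Context: $\mathbb{N} = \{0,1,2,\dots\}$. For $n \in \mathbb{N}$, $p_n$ denotes the $(n+1)$-th prime number (so $p_0 = 2$, $p_1 = 3$, $p_2=5$, ...). For $n \ge 1$, $r_n$ denotes the remainder of $p_n$ in the Euclidean division by $n$, so $p_n - r_n = n\lfloor p_n/n\rfloor$. The value $r_0 \in \mathbb{N}$ is fixed arbitrarily. An existential formula is one of the form $\exists u_1 \cdots \exists u_s\, \psi$ with $\psi$ quantifier-free. *)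

theory Defs
  imports "HOL-Library.Infinite_Set" "HOL-Computational_Algebra.Primes"
begin

definition nth_prime :: "nat \<Rightarrow> nat" where
  "nth_prime n = enumerate {p. prime p} n"

(* The parameter r0 is the arbitrarily fixed value at index 0. *)
definition prime_rem :: "nat \<Rightarrow> nat \<Rightarrow> nat" where
  "prime_rem r0 n = (if n = 0 then r0 else nth_prime n mod n)"

(* First-order syntax over one binary and two unary function symbols, without
   constants; variables are named by natural numbers. *)
datatype tm =
    Var nat
  | Add tm tm
  | PrimeFn tm
  | RemFn tm

datatype fm =
    Eq tm tm
  | Neg fm
  | Conj fm fm
  | Disj fm fm
  | Ex nat fm
  | All nat fm

fun tm_vars :: "tm \<Rightarrow> nat set" where
  "tm_vars (Var i) = {i}"
| "tm_vars (Add s t) = tm_vars s \<union> tm_vars t"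
| "tm_vars (PrimeFn t) = tm_vars t"
| "tm_vars (RemFn t) = tm_vars t"

fun free_vars :: "fm \<Rightarrow> nat set" where
  "free_vars (Eq s t) = tm_vars s \<union> tm_vars t"
| "free_vars (Neg \<phi>) = free_vars \<phi>"
| "free_vars (Conj \<phi> \<psi>) = free_vars \<phi> \<union> free_vars \<psi>"
| "free_vars (Disj \<phi> \<psi>) = free_vars \<phi> \<union> free_vars \<psi>"
| "free_vars (Ex i \<phi>) = free_vars \<phi> - {i}"
| "free_vars (All i \<phi>) = free_vars \<phi> - {i}"

fun quantifier_free :: "fm \<Rightarrow> bool" where
  "quantifier_free (Eq s t) = True"
| "quantifier_free (Neg \<phi>) = quantifier_free \<phi>"
| "quantifier_free (Conj \<phi> \<psi>) = (quantifier_free \<phi> \<and> quantifier_free \<psi>)"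
| "quantifier_free (Disj \<phi> \<psi>) = (quantifier_free \<phi> \<and> quantifier_free \<psi>)"
| "quantifier_free (Ex i \<phi>) = False"
| "quantifier_free (All i \<phi>) = False"

definition existential :: "fm \<Rightarrow> bool" where
  "existential \<phi> \<longleftrightarrow> (\<exists>us \<psi>. quantifier_free \<psi> \<and> \<phi> = foldr Ex us \<psi>)"

(* Interpretation in the structure of natural numbers with addition, nth_prime
   and prime_rem r0, under the variable assignment e. *)
fun tm_val :: "nat \<Rightarrow> (nat \<Rightarrow> nat) \<Rightarrow> tm \<Rightarrow> nat" where
  "tm_val r0 e (Var i) = e i"
| "tm_val r0 e (Add s t) = tm_val r0 e s + tm_val r0 e t"
| "tm_val r0 e (PrimeFn t) = nth_prime (tm_val r0 e t)"
| "tm_val r0 e (RemFn t) = prime_rem r0 (tm_val r0 e t)"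

fun sat :: "nat \<Rightarrow> (nat \<Rightarrow> nat) \<Rightarrow> fm \<Rightarrow> bool" where
  "sat r0 e (Eq s t) \<longleftrightarrow> tm_val r0 e s = tm_val r0 e t"
| "sat r0 e (Neg \<phi>) \<longleftrightarrow> \<not> sat r0 e \<phi>"
| "sat r0 e (Conj \<phi> \<psi>) \<longleftrightarrow> sat r0 e \<phi> \<and> sat r0 e \<psi>"
| "sat r0 e (Disj \<phi> \<psi>) \<longleftrightarrow> sat r0 e \<phi> \<or> sat r0 e \<psi>"
| "sat r0 e (Ex i \<phi>) \<longleftrightarrow> (\<exists>a. sat r0 (e(i := a)) \<phi>)"
| "sat r0 e (All i \<phi>) \<longleftrightarrow> (\<forall>a. sat r0 (e(i := a)) \<phi>)"

(* Variables 0, 1, 2 play the roles of x, y, z. The default value 0 of the other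
   variables is irrelevant when free_vars \<phi> \<subseteq> {0, 1, 2}. *)
definition sat3 :: "nat \<Rightarrow> fm \<Rightarrow> nat \<Rightarrow> nat \<Rightarrow> nat \<Rightarrow> bool" where
  "sat3 r0 \<phi> x y z \<longleftrightarrow> sat r0 ((\<lambda>_. 0)(0 := x, 1 := y, 2 := z)) \<phi>"

end

theory Submission
  imports Defs "HOL-Number_Theory.Prime_Powers" "HOL-Real_Asymp.Real_Asymp" "HOL-Analysis.Summation_Tests"
begin

text \<open>
  Put \<open>q n = \<lfloor>p\<^sub>n / n\<rfloor>\<close>, so that \<open>p\<^sub>n - r\<^sub>n = n * q n\<close>. If \<open>q\<close> varies by at most one between \<open>n\<close> and
  \<open>n + w\<close>, then the difference of \<open>n * q n\<close> at these two indices determines \<open>w * q n\<close> up to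
  \<open>0\<close> or \<open>\<plusminus>(n + w)\<close>, and the size constraint \<open>w * q n < n\<close>, which follows from \<open>w \<le> q n\<close>, removes the
  ambiguity. Hence multiplication of \<open>w\<close> by any value \<open>K\<close> of \<open>q\<close> attained at such an index is
  existentially definable. A general product is reduced to these: if
  \<open>x * (K\<^sub>5 - K\<^sub>6) = K\<^sub>1 + K\<^sub>2 - K\<^sub>3 - K\<^sub>4\<close> with \<open>K\<^sub>5 \<noteq> K\<^sub>6\<close>, then \<open>z = x * y\<close> iff
  \<open>z * (K\<^sub>5 - K\<^sub>6) = (K\<^sub>1 + K\<^sub>2 - K\<^sub>3 - K\<^sub>4) * y\<close>.

  Such a representation of \<open>x\<close> exists by the pigeonhole principle as soon as the admissible
  values of \<open>q\<close> have gaps \<open>O(\<surd>t)\<close> at height \<open>t\<close>: sums of two of them then have gaps \<open>O(t\<^sup>1\<^sup>/\<^sup>4)\<close>, which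
  are much smaller than the number \<open>\<surd>t\<close> of available values. The gap bound needs no
  prime number theorem. Since \<open>p\<^sub>n / n\<close> decreases only slowly, skipping an interval \<open>(A, B)\<close> forces
  \<open>p\<^sub>n < (A + 1) n\<close> up to some \<open>N\<close> and \<open>p\<^sub>n \<ge> (B - 1) n\<close> beyond it, and comparing \<open>\<Sum> ln p / p\<close> with Mertens' first
  theorem over ranges of logarithmic length \<open>\<surd>(ln N)\<close> on both sides gives \<open>B - A = O(\<surd>A)\<close>.
\<close>

section \<open>Mertens' first theorem\<close>

lemma card_multiples_atMost:
  fixes d N :: nat
  assumes "d > 0"
  shows "card {n \<in> {1..N}. d dvd n} = N div d"
proof -
  have "bij_betw (\<lambda>k. d * k) {1..N div d} {n \<in> {1..N}. d dvd n}"
  proof (rule bij_betwI[where g = "\<lambda>n. n div d"])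
    show "(\<lambda>k. d * k) \<in> {1..N div d} \<rightarrow> {n \<in> {1..N}. d dvd n}"
      using assms by (auto simp: less_eq_div_iff_mult_less_eq mult.commute)
    show "(\<lambda>n. n div d) \<in> {n \<in> {1..N}. d dvd n} \<rightarrow> {1..N div d}"
      using assms by (auto simp: less_eq_div_iff_mult_less_eq mult.commute elim!: dvdE)
  qed (use assms in auto)
  then show ?thesis by (auto dest!: bij_betw_same_card)
qed

text \<open>Each \<open>ln n\<close> is the sum of \<open>mangoldt\<close> over the divisors of
  \<open>n\<close>; after exchanging the sums, \<open>d\<close> is counted once for each of its
  \<open>N div d\<close> multiples up to \<open>N\<close>.\<close>

lemma ln_fact_eq_sum_mangoldt:
  "ln (fact N :: real) = (\<Sum>d\<in>{1..N}. mangoldt d * real (N div d))"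
proof -
  have "ln (fact N :: real) = (\<Sum>n\<in>{1..N}. ln (real n))"
    unfolding fact_prod of_nat_prod by (subst ln_prod) auto
  also have "\<dots> = (\<Sum>n\<in>{1..N}. \<Sum>d | d dvd n. mangoldt d)"
    by (intro sum.cong) (auto simp: mangoldt_sum)
  also have "\<dots> = (\<Sum>n\<in>{1..N}. \<Sum>d\<in>{1..N}. if d dvd n then mangoldt d else 0)"
  proof (rule sum.cong[OF refl])
    fix n assume n: "n \<in> {1..N}"
    have "{d. d dvd n} = {d \<in> {1..N}. d dvd n}"
      using n by (auto dest: dvd_imp_le intro: Nat.gr0I)
    then show "(\<Sum>d | d dvd n. mangoldt d) = (\<Sum>d\<in>{1..N}. if d dvd n then mangoldt d else (0::real))"
      by (simp only: sum.inter_filter finite_atLeastAtMost)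
  qed
  also have "\<dots> = (\<Sum>d\<in>{1..N}. \<Sum>n\<in>{1..N}. if d dvd n then mangoldt d else 0)"
    by (rule sum.swap)
  also have "\<dots> = (\<Sum>d\<in>{1..N}. mangoldt d * real (N div d))"
  proof (rule sum.cong[OF refl])
    fix d assume d: "d \<in> {1..N}"
    have "(\<Sum>n\<in>{1..N}. if d dvd n then mangoldt d else 0) =
        (\<Sum>n\<in>{n\<in>{1..N}. d dvd n}. mangoldt d :: real)"
      by (subst sum.inter_filter) auto
    also have "\<dots> = mangoldt d * real (N div d)"
      using card_multiples_atMost[of d N] d by simp
    finally show "(\<Sum>n\<in>{1..N}. if d dvd n then mangoldt d else 0) = mangoldt d * real (N div d)" .
  qed
  finally show ?thesis .
qed

text \<open>Chebyshev's argument: the logarithm of the central binomial coefficient is at most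
  \<open>2 * N\<close>, and in its von Mangoldt expansion the weight
  \<open>2*N div d - 2 * (N div d)\<close> is nonnegative everywhere and at least 1 for
  \<open>N < d <= 2*N\<close>.\<close>

lemma sum_mangoldt_double_le:
  "(\<Sum>d\<in>{1..2*N}. mangoldt d) \<le> (\<Sum>d\<in>{1..N}. mangoldt d) + 2 * real N"
proof -
  have "ln (fact (2*N) :: real) - 2 * ln (fact N) = ln (real (2*N choose N))"
    by (simp add: binomial_fact ln_div ln_mult power2_eq_square)
  also have "\<dots> \<le> ln (2 ^ (2*N))"
  proof -
    have "real (2*N choose N) \<le> real (2 ^ (2*N))"
      by (intro of_nat_mono binomial_le_pow2)
    then have "real (2*N choose N) \<le> 2 ^ (2*N)" by simp
    moreover have "real (2*N choose N) > 0" by simp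
    ultimately show ?thesis by (intro ln_mono)
  qed
  also have "\<dots> \<le> 2 * real N"
    using ln_2_less_1 by (simp add: ln_realpow mult_left_le)
  finally have 1: "ln (fact (2*N) :: real) - 2 * ln (fact N) \<le> 2 * real N" .
  have 2: "ln (fact N :: real) = (\<Sum>d\<in>{1..2*N}. mangoldt d * real (N div d))"
    unfolding ln_fact_eq_sum_mangoldt by (rule sum.mono_neutral_left) auto
  have "(\<Sum>d\<in>{1..2*N}. if d \<le> N then 0 else mangoldt d) \<le>
      (\<Sum>d\<in>{1..2*N}. mangoldt d * (real (2*N div d) - 2 * real (N div d)))"
  proof (rule sum_mono)
    fix d assume d: "d \<in> {1..2*N}"
    have "2 * (N div d) \<le> 2 * N div d"
      using d by (simp add: less_eq_div_iff_mult_less_eq)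
    then have a: "0 \<le> real (2*N div d) - 2 * real (N div d)" by linarith
    have b: "1 \<le> real (2*N div d) - 2 * real (N div d)" if "N < d"
    proof -
      have "1 \<le> 2 * N div d" using d that by (simp add: less_eq_div_iff_mult_less_eq)
      then show ?thesis using that by simp
    qed
    show "(if d \<le> N then 0 else mangoldt d) \<le> mangoldt d * (real (2*N div d) - 2 * real (N div d))"
    proof (cases "d \<le> N")
      case True
      then show ?thesis using a mangoldt_nonneg[of d] by simp
    next
      case False
      then show ?thesis using mult_left_mono[OF b mangoldt_nonneg[of d]] by simp
    qed
  qed
  also have "\<dots> = ln (fact (2*N)) - 2 * ln (fact N)"
    unfolding 2 unfolding ln_fact_eq_sum_mangoldt
    by (simp add: sum_subtractf right_diff_distrib sum_distrib_left mult.left_commute)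
  also note 1
  finally have 3: "(\<Sum>d\<in>{1..2*N}. if d \<le> N then 0 else mangoldt d) \<le> 2 * real N" .
  define S where "S = (\<Sum>d\<in>{1..2*N} - {..N}. mangoldt d :: real)"
  have "S = (\<Sum>d\<in>{1..2*N}. if d \<le> N then 0 else mangoldt d)"
    unfolding S_def by (rule sum.mono_neutral_cong_left) auto
  with 3 have "S \<le> 2 * real N" by (simp only:)
  moreover have "(\<Sum>d\<in>{1..2*N}. mangoldt d) = (\<Sum>d\<in>{1..2*N} \<inter> {..N}. mangoldt d) + S"
    unfolding S_def by (rule sum.Int_Diff) simp
  moreover have "{1..2*N} \<inter> {..N} = {1..N}" by auto
  ultimately show ?thesis by simp
qed

text \<open>Halving \<open>N\<close> in a strong induction. An odd \<open>N = 2*M + 1\<close> is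
  rounded up to \<open>2 * (M + 1)\<close>; the resulting \<open>6 * (M + 1)\<close> is at most
  \<open>4 * N\<close> because \<open>M >= 1\<close>.\<close>

lemma sum_mangoldt_le: "(\<Sum>d\<in>{1..N}. mangoldt d) \<le> 4 * real N"
proof (induction N rule: less_induct)
  case (less N)
  consider "N \<le> 1" | M where "N = 2*M" "M \<ge> 1" | M where "N = 2*M+1" "M \<ge> 1"
  proof (cases "even N")
    case True
    then have "N = 2 * (N div 2)" by simp
    then show ?thesis using that(1) that(2)[of "N div 2"] by linarith
  next
    case False
    then have "N = 2 * (N div 2) + 1" by simp
    then show ?thesis using that(1) that(3)[of "N div 2"] by linarith
  qed
  then show ?case
  proof cases
    case 1
    then show ?thesis by (cases N) auto
  next
    case 2
    have "(\<Sum>d\<in>{1..N}. mangoldt d) \<le> (\<Sum>d\<in>{1..M}. mangoldt d) + 2 * real M"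
      using sum_mangoldt_double_le[of M] 2 by simp
    with less.IH[of M] 2 show ?thesis by simp
  next
    case 3
    have "(\<Sum>d\<in>{1..N}. mangoldt d :: real) \<le> (\<Sum>d\<in>{1..2*(M+1)}. mangoldt d)"
      using 3 by (intro sum_mono2) (auto simp: mangoldt_nonneg)
    also have "\<dots> \<le> (\<Sum>d\<in>{1..M+1}. mangoldt d) + 2 * real (M+1)"
      by (rule sum_mangoldt_double_le)
    finally show ?thesis using less.IH[of "M+1"] 3 by simp
  qed
qed

section \<open>Stirling-type bounds and the sum of \<open>mangoldt d / d\<close>\<close>

lemma ln_fact_le: "ln (fact N :: real) \<le> real N * ln (real N)"
proof (cases "N = 0")
  case False
  have "(fact N :: real) \<le> real N ^ N" using fact_le_power[of N] by simp
  then have "ln (fact N :: real) \<le> ln (real N ^ N)" using False by (subst ln_le_cancel_iff) auto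
  then show ?thesis using False by (simp add: ln_realpow)
qed auto

lemma ln_fact_ge: "N > 0 \<Longrightarrow> ln (fact N :: real) \<ge> real N * ln (real N) - real N"
proof (induction N rule: nat_induct_non_zero)
  case 1
  then show ?case by simp
next
  case (Suc n)
  have "ln (real (Suc n)) - ln (real n) = ln (1 + 1 / real n)"
    proof -
    have "1 + 1 / real n = real (Suc n) / real n" using Suc.hyps by (simp add: field_simps)
    then show ?thesis using Suc.hyps by (simp add: ln_div)
  qed
  also have "\<dots> \<le> 1 / real n" using Suc.hyps by (intro ln_add_one_self_le_self) auto
  finally have "real n * (ln (real (Suc n)) - ln (real n)) \<le> real n * (1 / real n)"
    by (intro mult_left_mono) auto
  then have "real n * (ln (real (Suc n)) - ln (real n)) \<le> 1" using Suc.hyps by simp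
  moreover have "ln (fact (Suc n) :: real) = ln (real (Suc n)) + ln (fact n)"
    by (simp add: ln_mult)
  ultimately show ?case using Suc.IH by (simp add: algebra_simps)
qed

lemma sum_mangoldt_over_ge:
  assumes "N > 0"
  shows "(\<Sum>d\<in>{1..N}. mangoldt d / real d) \<ge> ln (real N) - 1"
proof -
  have "real N * ln (real N) - real N \<le> (\<Sum>d\<in>{1..N}. mangoldt d * real (N div d))"
    using ln_fact_ge[OF assms] by (simp add: ln_fact_eq_sum_mangoldt)
  also have "\<dots> \<le> (\<Sum>d\<in>{1..N}. mangoldt d * (real N / real d))"
    by (intro sum_mono mult_left_mono mangoldt_nonneg of_nat_div_le_of_nat)
  also have "\<dots> = real N * (\<Sum>d\<in>{1..N}. mangoldt d / real d)"
    by (simp add: sum_distrib_left mult_ac)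
  finally have "real N * (ln (real N) - 1) \<le> real N * (\<Sum>d\<in>{1..N}. mangoldt d / real d)"
    by (simp add: algebra_simps)
  with assms show ?thesis by (simp add: mult_le_cancel_left)
qed

text \<open>Replacing \<open>N div d\<close> by \<open>N / d\<close> in the expansion of
  \<open>ln (fact N)\<close> costs at most the plain von Mangoldt sum; the 4 is Chebyshev's
  constant.\<close>

lemma sum_mangoldt_over_le:
  assumes "N > 0"
  shows "(\<Sum>d\<in>{1..N}. mangoldt d / real d) \<le> ln (real N) + 4"
proof -
  have "real N * (\<Sum>d\<in>{1..N}. mangoldt d / real d) - (\<Sum>d\<in>{1..N}. mangoldt d)
      = (\<Sum>d\<in>{1..N}. mangoldt d * (real N / real d - 1))"
    by (simp add: sum_distrib_left sum_subtractf right_diff_distrib mult_ac)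
  also have "\<dots> \<le> (\<Sum>d\<in>{1..N}. mangoldt d * real (N div d))"
  proof (intro sum_mono mult_left_mono mangoldt_nonneg)
    fix d assume "d \<in> {1..N}"
    show "real N / real d - 1 \<le> real (N div d)"
      using floor_divide_of_nat_eq[of N d, where ?'a = real] by linarith
  qed
  also have "\<dots> \<le> real N * ln (real N)"
    using ln_fact_le[of N] by (simp add: ln_fact_eq_sum_mangoldt)
  finally have "real N * (\<Sum>d\<in>{1..N}. mangoldt d / real d) \<le> real N * (ln (real N) + 4)"
    using sum_mangoldt_le[of N] by (simp add: algebra_simps)
  with assms show ?thesis by (simp add: mult_le_cancel_left)
qed

text \<open>Only the powers \<open>p ^ Suc k\<close> with \<open>k >= 1\<close> contribute. For
  fixed \<open>p\<close> they form a geometric series with sum at most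
  \<open>ln p / (p * (p - 1))\<close>, and these values are summable even over all integers.\<close>

lemma sum_nonprime_mangoldt_bounded:
  "\<exists>C\<ge>0. \<forall>N. (\<Sum>d | d \<in> {1..N} \<and> \<not> prime d. mangoldt d / real d) \<le> C"
proof -
  define u where "u = (\<lambda>n::nat. ln (real n) / (real n * (real n - 1)))"
  have "summable u"
  proof (rule summable_comparison_test_bigo)
    show "summable (\<lambda>n. norm (real n powr (-3/2)))"
      by (simp add: summable_real_powr_iff)
    show "u \<in> O(\<lambda>n. real n powr (-3/2))"
      unfolding u_def by real_asymp
  qed
  have u_nonneg: "u n \<ge> 0" for n
    by (cases "n = 0") (auto simp: u_def intro!: divide_nonneg_nonneg mult_nonneg_nonneg)
  have "(\<Sum>d | d \<in> {1..N} \<and> \<not> prime d. mangoldt d / real d) \<le> suminf u" for N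
  proof -
    define A where "A = {d \<in> {1..N}. \<not> prime d \<and> primepow d}"
    define f where "f = (\<lambda>(p::nat,k::nat). p ^ Suc k)"
    have bij: "bij_betw f (Collect prime \<times> UNIV) (Collect primepow)"
      unfolding f_def by (rule bij_betw_primepows)
    \<comment> \<open>A finite box containing all exponent pairs that occur:
      \<open>Suc k < p ^ Suc k <= N\<close> bounds the exponent, and \<open>k = 0\<close> is
      excluded since it yields a prime.\<close>
    define B where "B = {p. prime p \<and> p \<le> N} \<times> {1..N}"
    have inj: "inj_on f B"
      using bij by (auto simp: bij_betw_def B_def intro: inj_on_subset)
    have AB: "A \<subseteq> f ` B"
    proof
      fix d assume d: "d \<in> A"
      then have "d \<in> f ` (Collect prime \<times> UNIV)" using bij by (auto simp: bij_betw_def A_def)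
      then obtain p k where pk: "prime p" "d = p ^ Suc k" by (auto simp: f_def)
      have "k \<noteq> 0"
      proof
        assume "k = 0"
        then have "prime d" using pk by simp
        then show False using d by (simp add: A_def)
      qed
      have "p \<le> p ^ Suc k" using pk(1) prime_gt_0_nat[of p] by simp
      have "Suc k < p ^ Suc k" using pk(1) prime_gt_1_nat[of p] by (intro power_gt_expt) auto
      moreover have "p ^ Suc k \<le> N" using d unfolding A_def pk(2) by simp
      ultimately have "(p, k) \<in> B" using \<open>k \<noteq> 0\<close> \<open>p \<le> p ^ Suc k\<close> pk(1)
        unfolding B_def by (simp del: power_Suc)
      moreover have "d = f (p, k)" using pk(2) by (simp add: f_def)
      ultimately show "d \<in> f ` B" by blast
    qed
    have "finite B" unfolding B_def by auto
    have "(\<Sum>d | d \<in> {1..N} \<and> \<not> prime d. mangoldt d / real d) = (\<Sum>d\<in>A. mangoldt d / real d)"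
      by (rule sum.mono_neutral_right) (auto simp: A_def mangoldt_def)
    also have "\<dots> \<le> (\<Sum>d\<in>f ` B. mangoldt d / real d)"
      using AB \<open>finite B\<close> by (intro sum_mono2) (auto simp: mangoldt_nonneg)
    also have "\<dots> = (\<Sum>pk\<in>B. mangoldt (f pk) / real (f pk))"
      by (simp add: sum.reindex[OF inj])
    also have "\<dots> = (\<Sum>(p,k)\<in>B. ln (real p) / real p ^ Suc k)"
      by (rule sum.cong) (auto simp: B_def f_def mangoldt_primepow simp del: power_Suc)
    also have "\<dots> = (\<Sum>p | prime p \<and> p \<le> N. \<Sum>k\<in>{1..N}. ln (real p) / real p ^ Suc k)"
      unfolding B_def by (rule sum.cartesian_product [symmetric])
    also have "\<dots> \<le> (\<Sum>p | prime p \<and> p \<le> N. u p)"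
    proof (intro sum_mono)
      fix p assume "p \<in> {p. prime p \<and> p \<le> N}"
      then have p: "p > 1" using prime_gt_1_nat by blast
      define x where "x = 1 / real p"
      have x: "0 < x" "x < 1" using p by (auto simp: x_def)
      have 1: "(\<Sum>k\<in>{1..N}. ln (real p) / real p ^ Suc k) = ln (real p) * x * (\<Sum>k\<in>{1..N}. x ^ k)"
        by (simp add: sum_distrib_left x_def power_divide mult_ac)
      have 2: "(\<Sum>k\<in>{1..N}. x ^ k) \<le> x / (1 - x)"
      proof -
        have "(\<Sum>k\<in>{1..N}. x ^ k) = x * (\<Sum>k<N. x ^ k)"
          by (simp add: sum_distrib_left sum.atLeast1_atMost_eq)
        also have "(\<Sum>k<N. x ^ k) = (1 - x ^ N) / (1 - x)"
          using x by (subst sum_gp_strict) auto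
        also have "x * \<dots> \<le> x * (1 / (1 - x))"
          using x by (intro mult_left_mono divide_right_mono) auto
        finally show ?thesis by simp
      qed
      have 3: "ln (real p) * x * (x / (1 - x)) = u p"
        using p by (simp add: u_def x_def field_simps)
      have "0 \<le> ln (real p) * x" using p x by simp
      from mult_left_mono[OF 2 this] show "(\<Sum>k\<in>{1..N}. ln (real p) / real p ^ Suc k) \<le> u p"
        unfolding 1 3 .
    qed
    also have "\<dots> \<le> suminf u"
      using \<open>summable u\<close> u_nonneg by (intro sum_le_suminf) auto
    finally show ?thesis .
  qed
  moreover have "suminf u \<ge> 0" by (intro suminf_nonneg \<open>summable u\<close> u_nonneg)
  ultimately show ?thesis by blast
qed

definition mertens_sum :: "nat \<Rightarrow> real" where
  "mertens_sum N = (\<Sum>p | prime p \<and> p \<le> N. ln (real p) / real p)"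

text \<open>The full von Mangoldt sum lies between \<open>ln N - 1\<close> and
  \<open>ln N + 4\<close>, and the part \<open>X\<close> that does not come from primes lies between
  0 and \<open>C\<close>.\<close>

lemma mertens:
  "\<exists>E\<ge>0. \<forall>N>0. \<bar>mertens_sum N - ln (real N)\<bar> \<le> E"
proof -
  obtain C where C: "C \<ge> 0" 
    "\<And>N. (\<Sum>d | d \<in> {1..N} \<and> \<not> prime d. mangoldt d / real d) \<le> C"
    using sum_nonprime_mangoldt_bounded by blast
  have "\<bar>mertens_sum N - ln (real N)\<bar> \<le> C + 4" if "N > 0" for N
  proof -
    define X where "X = (\<Sum>d | d \<in> {1..N} \<and> \<not> prime d. mangoldt d / real d)"
    have "(\<Sum>d\<in>{1..N}. mangoldt d / real d) =
      (\<Sum>d\<in>{1..N} \<inter> {d. prime d}. mangoldt d / real d) + (\<Sum>d\<in>{1..N} - {d. prime d}. mangoldt d / real d)"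
      by (rule sum.Int_Diff) simp
    also have "{1..N} - {d. prime d} = {d. d \<in> {1..N} \<and> \<not> prime d}" by auto
    also have "(\<Sum>d\<in>{1..N} \<inter> {d. prime d}. mangoldt d / real d) = mertens_sum N"
      unfolding mertens_sum_def using prime_ge_1_nat by (intro sum.cong) auto
    finally have "(\<Sum>d\<in>{1..N}. mangoldt d / real d) = mertens_sum N + X" by (simp add: X_def)
    moreover have "X \<ge> 0" unfolding X_def by (intro sum_nonneg) (auto simp: mangoldt_nonneg)
    moreover have "X \<le> C" unfolding X_def by (rule C)
    ultimately show ?thesis
      using sum_mangoldt_over_ge[OF that] sum_mangoldt_over_le[OF that] C(1) by linarith
  qed
  with C(1) show ?thesis by (intro exI[of _ "C + 4"]) auto
qed

section \<open>The quotients of primes by their indices\<close>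

lemma prime_nth_prime: "prime (nth_prime n)"
  using enumerate_in_set[OF primes_infinite, of n] by (simp add: nth_prime_def)

lemma nth_prime_less_iff [simp]: "nth_prime m < nth_prime n \<longleftrightarrow> m < n"
  unfolding nth_prime_def by (rule enumerate_mono_iff[OF primes_infinite])

lemma nth_prime_le_iff [simp]: "nth_prime m \<le> nth_prime n \<longleftrightarrow> m \<le> n"
  unfolding nth_prime_def by (rule enumerate_mono_le_iff[OF primes_infinite])

lemma inj_nth_prime: "inj nth_prime"
  unfolding nth_prime_def by (rule inj_enumerate[OF primes_infinite])

lemma primes_le_nth_prime: "{p. prime p \<and> p \<le> nth_prime n} = nth_prime ` {..n}"
proof
  show "{p. prime p \<and> p \<le> nth_prime n} \<subseteq> nth_prime ` {..n}"
  proof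
    fix p assume p: "p \<in> {p. prime p \<and> p \<le> nth_prime n}"
    then obtain i where "p = nth_prime i"
      using enumerate_Ex[of "{p. prime p}" p] primes_infinite by (auto simp: nth_prime_def)
    with p show "p \<in> nth_prime ` {..n}" by simp
  qed
qed (auto simp: prime_nth_prime)

lemma nth_prime_ge: "nth_prime n \<ge> Suc n"
proof (induction n)
  case 0
  show ?case using prime_nth_prime[of 0] prime_gt_0_nat[of "nth_prime 0"] by simp
next
  case (Suc n)
  have "nth_prime n < nth_prime (Suc n)" by simp
  with Suc show ?case by linarith
qed

lemma nth_prime_pos [simp]: "nth_prime n > 0"
  using nth_prime_ge[of n] by simp

section \<open>Lower and upper bounds for the primes in terms of their indices\<close>

lemma mertens_sum_nth_prime:
  "mertens_sum (nth_prime n) = (\<Sum>i\<le>n. ln (real (nth_prime i)) / real (nth_prime i))"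
  unfolding mertens_sum_def primes_le_nth_prime
  by (subst sum.reindex) (auto intro: inj_on_subset[OF inj_nth_prime])

text \<open>Since the prime of index \<open>i\<close> exceeds \<open>i\<close>,
  \<open>ln (fact n)\<close> is at most the sum of the logarithms of primes up to
  \<open>nth_prime n\<close>, which Chebyshev's bound controls.\<close>

lemma nth_prime_lower: "real n * (ln (real n) - 1) \<le> 4 * real (nth_prime n)"
proof (cases "n = 0")
  case False
  have "real n * (ln (real n) - 1) \<le> ln (fact n)"
    using ln_fact_ge[of n] False by (simp add: algebra_simps)
  also have "ln (fact n :: real) = (\<Sum>i\<in>{1..n}. ln (real i))"
    unfolding fact_prod of_nat_prod by (subst ln_prod) auto
  also have "\<dots> \<le> (\<Sum>i\<in>{1..n}. ln (real (nth_prime i)))"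
  proof (rule sum_mono)
    fix i assume "i \<in> {1..n}"
    then show "ln (real i) \<le> ln (real (nth_prime i))"
      using nth_prime_ge[of i] by (intro ln_mono) auto
  qed
  also have "\<dots> = (\<Sum>p\<in>nth_prime ` {1..n}. mangoldt p)"
    by (subst sum.reindex) (auto intro: inj_on_subset[OF inj_nth_prime] simp: prime_nth_prime)
  also have "\<dots> \<le> (\<Sum>p\<in>{1..nth_prime n}. mangoldt p)"
    by (rule sum_mono2) (auto simp: mangoldt_nonneg Suc_le_eq)
  also have "\<dots> \<le> 4 * real (nth_prime n)" by (rule sum_mangoldt_le)
  finally show ?thesis .
qed simp

lemma ln_le_two_sqrt: "x > 0 \<Longrightarrow> ln x \<le> 2 * sqrt (x::real)"
  using ln_le_minus_one[of "sqrt x"] by (simp add: ln_sqrt)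

text \<open>With \<open>N = nth_prime n\<close>, the primes in \<open>(N / A, N]\<close> carry
  Mertens mass at least 1, each contributes at most \<open>A * ln N / N\<close>, and there are at
  most \<open>n + 1\<close> of them; so \<open>N <= A * (n + 1) * ln N\<close>. A crude bound on
  \<open>N\<close> then replaces \<open>ln N\<close> by a multiple of \<open>ln n\<close>.\<close>

lemma nth_prime_upper:
  "\<exists>C\<ge>1. \<forall>n\<ge>2. real (nth_prime n) \<le> C * real n * ln (real n)"
proof -
  obtain E where E: "E \<ge> 0" "\<And>N. N > 0 \<Longrightarrow> \<bar>mertens_sum N - ln (real N)\<bar> \<le> E"
    using mertens by blast
  \<comment> \<open>\<open>ln A\<close> is the Mertens error at both ends of the interval plus 1, so
    a mass of at least 1 remains.\<close>
  define A where "A = exp (2 * E + 1)"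
  have A: "A \<ge> 1" using E by (simp add: A_def)
  \<comment> \<open>Chosen so that \<open>ln (2 * A) <= K * ln n\<close> for all
    \<open>n >= 2\<close>.\<close>
  define K where "K = ln (2 * A) / ln 2"
  define C where "C = 4 * A * (K + 2)"
  have "K \<ge> 0" unfolding K_def using A by (intro divide_nonneg_nonneg ln_ge_zero) auto
  have *: "real (nth_prime n) \<le> A * (real n + 1) * ln (real (nth_prime n))" if n: "n \<ge> 2" for n
  proof -
    define N where "N = nth_prime n"
    define m where "m = nat \<lfloor>real N / A\<rfloor>"
    have N: "N > 2" using nth_prime_ge[of n] n by (simp add: N_def)
    have lnN: "ln (real N) \<ge> 1/2"
    proof -
      have "ln (1 / 2 :: real) \<le> 1 / 2 - 1" by (rule ln_le_minus_one) simp
      then have "ln (2::real) \<ge> 1/2" by (simp add: ln_div)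
      moreover have "ln 2 \<le> ln (real N)" using N by (intro ln_mono) auto
      ultimately show ?thesis by linarith
    qed
    have mA: "real m \<le> real N / A" "real N / A < real m + 1"
      using A by (auto simp: m_def) 
    show ?thesis
    proof (cases "m = 0")
      case True
      then have "real N \<le> A" using mA A by (simp add: field_simps)
      also have "A * 1 \<le> A * ((real n + 1) * ln (real N))"
        using lnN n A mult_mono[of 2 "real n + 1" "1/2" "ln (real N)"] by (intro mult_left_mono) auto
      finally show ?thesis by (simp add: N_def mult_ac)
    next
      case False
      have "m \<le> N"
      proof -
        have "real N / A \<le> real N / 1" using A by (intro divide_left_mono) auto
        with mA show ?thesis by linarith
      qed
      have "ln (real m) \<le> ln (real N / A)" using mA False by (intro ln_mono) auto
      also have "\<dots> = ln (real N) - (2 * E + 1)"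
        using N A by (subst ln_div) (auto simp: A_def)
      finally have "1 \<le> mertens_sum N - mertens_sum m"
        using E(2)[of N] E(2)[of m] False N by linarith
      also have "mertens_sum N - mertens_sum m = (\<Sum>p | prime p \<and> p \<le> N \<and> m < p. ln (real p) / real p)"
      proof -
        have "{p. prime p \<and> p \<le> N} = {p. prime p \<and> p \<le> m} \<union> {p. prime p \<and> p \<le> N \<and> m < p}"
          using \<open>m \<le> N\<close> by auto
        moreover have "(\<Sum>p\<in>{p. prime p \<and> p \<le> m} \<union> {p. prime p \<and> p \<le> N \<and> m < p}. ln (real p) / real p)
          = (\<Sum>p | prime p \<and> p \<le> m. ln (real p) / real p) + (\<Sum>p | prime p \<and> p \<le> N \<and> m < p. ln (real p) / real p)"
          by (rule sum.union_disjoint) auto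
        ultimately show ?thesis unfolding mertens_sum_def by (simp only: add_diff_cancel_left')
      qed
      also have "\<dots> \<le> (\<Sum>p | prime p \<and> p \<le> N \<and> m < p. ln (real N) * A / real N)"
      proof (rule sum_mono)
        fix p assume p: "p \<in> {p. prime p \<and> p \<le> N \<and> m < p}"
        then have "real m + 1 \<le> real p" by simp
        then have 1: "real N / A \<le> real p" using mA by linarith
        have "ln (real p) / real p \<le> ln (real N) / real p"
          using p by (intro divide_right_mono ln_mono) auto
        also have "\<dots> \<le> ln (real N) / (real N / A)"
          using 1 p lnN N A by (intro divide_left_mono) auto
        finally show "ln (real p) / real p \<le> ln (real N) * A / real N" by simp
      qed
      also have "\<dots> = real (card {p. prime p \<and> p \<le> N \<and> m < p}) * (ln (real N) * A / real N)"
        by simp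
      also have "\<dots> \<le> (real n + 1) * (ln (real N) * A / real N)"
      proof (rule mult_right_mono)
        have "card {p. prime p \<and> p \<le> N \<and> m < p} \<le> card (nth_prime ` {..n})"
          unfolding primes_le_nth_prime[symmetric] N_def[symmetric] by (rule card_mono) auto
        also have "\<dots> \<le> n + 1" using card_image_le[of "{..n}" nth_prime] by simp
        finally show "real (card {p. prime p \<and> p \<le> N \<and> m < p}) \<le> real n + 1" by linarith
        show "0 \<le> ln (real N) * A / real N" using lnN A by simp
      qed
      finally have "1 * real N \<le> (real n + 1) * (ln (real N) * A / real N) * real N"
        by (intro mult_right_mono) auto
      also have "\<dots> = A * (real n + 1) * ln (real N)" using N by simp
      finally show ?thesis by (simp add: N_def)
    qed
  qed
  have "real (nth_prime n) \<le> C * real n * ln (real n)" if n: "n \<ge> 2" for n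
  proof -
    define N where "N = real (nth_prime n)"
    have N: "N > 0" by (simp add: N_def)
    have ln2: "ln 2 \<le> ln (real n)" using n by (intro ln_mono) auto
    have lnn: "ln (real n) > 0" using n by simp
    \<comment> \<open>Bootstrap: \<open>ln N <= 2 * sqrt N\<close> makes \<open>N\<close> at most
      quadratic in \<open>n\<close>, hence \<open>ln N\<close> of order \<open>ln n\<close>.\<close>
    have "sqrt N * sqrt N \<le> A * (real n + 1) * (2 * sqrt N)"
    proof -
      have "sqrt N * sqrt N = N" using N by simp
      also have "N \<le> A * (real n + 1) * ln N" using *[OF n] by (simp add: N_def)
      also have "\<dots> \<le> A * (real n + 1) * (2 * sqrt N)"
        using A ln_le_two_sqrt[OF N] by (intro mult_left_mono) auto
      finally show ?thesis .
    qed
    then have "sqrt N * sqrt N \<le> (2 * A * (real n + 1)) * sqrt N" by (simp add: mult_ac)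
    then have "sqrt N \<le> 2 * A * (real n + 1)"
      using N mult_le_cancel_right_pos[of "sqrt N" "sqrt N"] by simp
    then have "ln (sqrt N) \<le> ln (2 * A * (real n + 1))" using N by (intro ln_mono) auto
    then have "ln N \<le> 2 * ln (2 * A * (real n + 1))" using N by (simp add: ln_sqrt)
    also have "ln (2 * A * (real n + 1)) = ln (2 * A) + ln (real n + 1)"
      using A by (subst ln_mult) auto
    also have "ln (real n + 1) \<le> ln (real n ^ 2)"
    proof (intro ln_mono)
      have "2 * real n \<le> real n * real n" using n by (intro mult_right_mono) auto
      moreover have "real n + 1 \<le> 2 * real n" using n by simp
      ultimately show "real n + 1 \<le> real n ^ 2" unfolding power2_eq_square by linarith
    qed auto
    also have "ln (real n ^ 2) = 2 * ln (real n)" using n by (simp add: ln_realpow)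
    finally have "ln N \<le> 2 * (ln (2 * A) + 2 * ln (real n))" by simp
    moreover have "ln (2 * A) \<le> K * ln (real n)"
    proof -
      have "K * ln 2 \<le> K * ln (real n)"
        using ln2 \<open>K \<ge> 0\<close> by (intro mult_left_mono) auto
      then show ?thesis by (simp add: K_def)
    qed
    then have "2 * (ln (2 * A) + 2 * ln (real n)) \<le> 2 * (K * ln (real n) + 2 * ln (real n))"
      by (intro mult_left_mono add_right_mono) auto
    ultimately have 1: "ln N \<le> 2 * ((K + 2) * ln (real n))"
      unfolding distrib_right by (rule order_trans)
    have "N \<le> A * (real n + 1) * ln N" using *[OF n] by (simp add: N_def)
    also have "\<dots> \<le> A * (2 * real n) * (2 * ((K + 2) * ln (real n)))"
    proof (rule mult_mono)
      show "A * (real n + 1) \<le> A * (2 * real n)" using A n by (intro mult_left_mono) auto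
      show "0 \<le> ln N" using nth_prime_ge[of n] by (simp add: N_def)
      show "0 \<le> A * (2 * real n)" using A by simp
    qed (fact 1)
    finally show ?thesis by (simp add: C_def N_def algebra_simps)
  qed
  moreover have "C \<ge> 1"
  proof -
    have "1 * 1 \<le> A * (4 * (K + 2))" using A \<open>K \<ge> 0\<close> by (intro mult_mono) auto
    then show ?thesis by (simp add: C_def mult_ac)
  qed
  ultimately show ?thesis by blast
qed

section \<open>Harmonic sums and Mertens sums between two indices\<close>

lemma sum_inverse_ge:
  assumes "M \<le> N"
  shows "ln ((real N + 1) / (real M + 1)) \<le> (\<Sum>i\<in>{M<..N}. 1 / real i)"
  using assms
proof (induction N rule: dec_induct)
  case base
  show ?case by simp
next
  case (step n)
  have "ln ((real (Suc n) + 1) / (real M + 1)) = ln ((real n + 1) / (real M + 1)) + ln (1 + 1 / real (Suc n))"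
  proof -
    have "1 + 1 / real (Suc n) = (real (Suc n) + 1) / (real n + 1)"
      by (simp add: field_simps)
    then have "(real (Suc n) + 1) / (real M + 1) = (real n + 1) / (real M + 1) * (1 + 1 / real (Suc n))"
      by simp
    also have "ln \<dots> = ln ((real n + 1) / (real M + 1)) + ln (1 + 1 / real (Suc n))"
      by (intro ln_mult_pos) (auto intro: add_pos_nonneg)
    finally show ?thesis .
  qed
  also have "ln (1 + 1 / real (Suc n)) \<le> 1 / real (Suc n)"
    by (intro ln_add_one_self_le_self) auto
  also have "{M<..Suc n} = insert (Suc n) {M<..n}" using step.hyps by auto
  ultimately show ?case using step.IH by simp
qed

lemma sum_inverse_le:
  assumes "M \<le> N" "M > 0"
  shows "(\<Sum>i\<in>{M<..N}. 1 / real i) \<le> ln (real N / real M)"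
  using assms(1)
proof (induction N rule: dec_induct)
  case base
  show ?case using assms by simp
next
  case (step n)
  have n: "n > 0" using step.hyps assms by simp
  have "ln (real n / real (Suc n)) \<le> real n / real (Suc n) - 1"
    using n by (intro ln_le_minus_one) auto
  also have "\<dots> = - (1 / real (Suc n))" by (simp add: field_simps)
  finally have "1 / real (Suc n) \<le> - ln (real n / real (Suc n))" by simp
  also have "\<dots> = ln (real (Suc n)) - ln (real n)" using n by (simp add: ln_div)
  finally have "1 / real (Suc n) \<le> ln (real (Suc n)) - ln (real n)" .
  moreover have "{M<..Suc n} = insert (Suc n) {M<..n}" using step.hyps by auto
  moreover have "ln (real (Suc n) / real M) = ln (real (Suc n)) - ln (real M)"
    "ln (real n / real M) = ln (real n) - ln (real M)"
    using n assms by (simp_all add: ln_div)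
  ultimately show ?case using step.IH by (simp del: of_nat_Suc)
qed

lemma mertens_sum_nth_prime_diff:
  assumes "M \<le> N"
  shows "mertens_sum (nth_prime N) - mertens_sum (nth_prime M)
    = (\<Sum>i\<in>{M<..N}. ln (real (nth_prime i)) / real (nth_prime i))"
proof -
  have "{..N} = {..M} \<union> {M<..N}" using assms by auto
  moreover have "sum g ({..M} \<union> {M<..N}) = sum g {..M} + sum g {M<..N}" for g :: "nat \<Rightarrow> real"
    by (rule sum.union_disjoint) auto
  ultimately show ?thesis unfolding mertens_sum_nth_prime by simp
qed

text \<open>Otherwise the primes are too dense: put \<open>l = sqrt (ln N)\<close> and
  \<open>a = l\<^sup>2 - C * l\<close>. If \<open>nth_prime i < a * i\<close> throughout, then on
  the indices from about \<open>N * exp (-l)\<close> to \<open>N\<close> the terms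
  \<open>ln p / p\<close> add up to at least \<open>(l\<^sup>2 - l) / a * (l - 2)\<close>, while
  Mertens allows only \<open>l + c\<close>.\<close>

lemma frequent_large_nth_prime_quotient:
  "\<exists>C N0. \<forall>N\<ge>N0. \<exists>i. sqrt (real N) \<le> real i \<and> i \<le> N \<and>
     (ln (real N) - C * sqrt (ln (real N))) * real i \<le> real (nth_prime i)"
proof -
  obtain E where E: "E \<ge> 0" "\<And>N. N > 0 \<Longrightarrow> \<bar>mertens_sum N - ln (real N)\<bar> \<le> E"
    using mertens by blast
  \<comment> \<open>\<open>2 * E\<close> is the Mertens error at two points. \<open>ln 8\<close> is
    what \<open>ln (nth_prime N) - ln (nth_prime M)\<close> can exceed \<open>l\<close> by, once the
    \<open>ln (l\<^sup>2)\<close> of the upper bound for \<open>nth_prime N\<close> cancels that of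
    the lower bound for \<open>nth_prime M\<close>.\<close>
  define c where "c = ln 8 + 2 * E"
  have c: "c \<ge> 0" using E by (simp add: c_def)
  \<comment> \<open>With this value the cubic and quadratic terms in \<open>l\<close> of the final
    inequality agree, and the linear ones contradict each other.\<close>
  define C where "C = c + 3"
  define N0 where "N0 = nat \<lceil>exp ((C + 5)\<^sup>2)\<rceil>"
  have "\<exists>i. sqrt (real N) \<le> real i \<and> i \<le> N \<and>
     (ln (real N) - C * sqrt (ln (real N))) * real i \<le> real (nth_prime i)" if N: "N \<ge> N0" for N
  proof (rule ccontr)
    assume contr: "\<nexists>i. sqrt (real N) \<le> real i \<and> i \<le> N \<and>
     (ln (real N) - C * sqrt (ln (real N))) * real i \<le> real (nth_prime i)"
    have N_ge: "exp ((C + 5)\<^sup>2) \<le> real N" using N unfolding N0_def by linarith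
    then have N_pos: "real N > 0" using exp_gt_zero[of "(C + 5)\<^sup>2"] by linarith
    have lnN: "(C + 5)\<^sup>2 \<le> ln (real N)" using N_ge N_pos by (simp add: ln_ge_iff)
    define l where "l = sqrt (ln (real N))"
    have l: "l \<ge> C + 5" unfolding l_def using lnN by (rule real_le_rsqrt)
    have l8: "l \<ge> 8" using l c by (simp add: C_def)
    have "0 \<le> ln (real N)" using lnN zero_le_power2[of "C + 5"] by linarith
    then have l2: "ln (real N) = l\<^sup>2" unfolding l_def by simp
    have N_exp: "real N = exp (l\<^sup>2)" using N_pos l2[symmetric] by simp
    define a where "a = l\<^sup>2 - C * l"
    have "l * (l - C) \<ge> 8 * 1" using l l8 by (intro mult_mono) auto
    then have a: "a \<ge> 1" by (simp add: a_def power2_eq_square algebra_simps)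
    have less: "real (nth_prime i) < a * real i" if "sqrt (real N) \<le> real i" "i \<le> N" for i
      
    proof (rule ccontr)
      assume "\<not> ?thesis"
      then have "(ln (real N) - C * sqrt (ln (real N))) * real i \<le> real (nth_prime i)"
        unfolding l_def[symmetric] by (simp add: a_def l2)
      with contr that show False by blast
    qed
    \<comment> \<open>Logarithmic length about \<open>l\<close> is long enough for the relative
      excess, of order \<open>(C - 1) / l\<close>, to add up to a constant, and short enough for
      \<open>ln p\<close> to stay close to \<open>l\<^sup>2\<close>.\<close>
    define M where "M = nat \<lceil>exp (l\<^sup>2 - l)\<rceil>"
    have exp1: "exp (l\<^sup>2 - l) \<ge> 1" using l8 by (simp add: power2_eq_square)
    have M: "exp (l\<^sup>2 - l) \<le> real M" "real M < exp (l\<^sup>2 - l) + 1"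
      unfolding M_def using exp1 by linarith+
    have M1: "M \<ge> 1" using M exp1 by linarith
    have "sqrt (real N) = exp (l\<^sup>2 / 2)"
      unfolding N_exp by (rule real_sqrt_unique) (simp_all add: power2_eq_square flip: exp_add)
    also have "\<dots> \<le> exp (l\<^sup>2 - l)" using l8 by (simp add: power2_eq_square field_simps)
    finally have sqrtM: "sqrt (real N) \<le> real M" using M by linarith
    have MN: "M \<le> N"
    proof -
      have "exp (l\<^sup>2 - l) \<le> real N" unfolding N_exp using l8 by simp
      then show ?thesis unfolding M_def by (simp add: nat_le_iff ceiling_le_iff)
    qed
    have lnM: "ln (real M) \<ge> l\<^sup>2 - l"
      using M M1 by (simp add: ln_ge_iff)
    have "(l\<^sup>2 - l) / a * (l - 2) \<le> mertens_sum (nth_prime N) - mertens_sum (nth_prime M)"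
    proof -
      have "l - 2 \<le> ln ((real N + 1) / (real M + 1))"
      proof -
        have "exp (l - 2) * (real M + 1) \<le> exp (l - 2) * (3 * exp (l\<^sup>2 - l))"
        proof (rule mult_left_mono)
          show "real M + 1 \<le> 3 * exp (l\<^sup>2 - l)" using M exp1 by linarith
        qed simp
        also have "\<dots> = 3 * exp (-2) * real N" unfolding N_exp
          by (simp flip: exp_add)
        also have "\<dots> \<le> 1 * real N"
        proof (intro mult_right_mono)
          have "(3::real) \<le> exp 2" using exp_ge_add_one_self[of "2::real"] by simp
          then show "3 * exp (-2) \<le> (1::real)" by (simp add: exp_minus field_simps)
        qed auto
        finally have "exp (l - 2) * (real M + 1) \<le> real N + 1" by simp
        then have "exp (l - 2) \<le> (real N + 1) / (real M + 1)" by (simp add: field_simps)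
        then show ?thesis by (subst ln_ge_iff) (auto intro: divide_pos_pos)
      qed
      also have "\<dots> \<le> (\<Sum>i\<in>{M<..N}. 1 / real i)" by (rule sum_inverse_ge[OF MN])
      finally have "(l\<^sup>2 - l) / a * (l - 2) \<le> (l\<^sup>2 - l) / a * (\<Sum>i\<in>{M<..N}. 1 / real i)"
        using a l8 by (intro mult_left_mono) (auto simp: power2_eq_square)
      also have "\<dots> = (\<Sum>i\<in>{M<..N}. (l\<^sup>2 - l) / a * (1 / real i))" by (rule sum_distrib_left)
      also have "\<dots> \<le> (\<Sum>i\<in>{M<..N}. ln (real (nth_prime i)) / real (nth_prime i))"
      proof (rule sum_mono)
        fix i assume i: "i \<in> {M<..N}"
        \<comment> \<open>\<open>ln x / x\<close> decreases only from \<open>exp 1\<close> on; this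
          monotonicity turns \<open>nth_prime i <= a * i\<close> into a lower bound for the
          term.\<close>
        have "exp 1 \<le> real (nth_prime i)"
        proof -
          have "nth_prime i \<ge> 3" using i M1 nth_prime_ge[of i] by auto
          then show ?thesis using exp_le by linarith
        qed
        moreover have "real (nth_prime i) \<le> a * real i"
          using less[of i] i sqrtM by auto
        ultimately have 1: "ln (a * real i) / (a * real i) \<le> ln (real (nth_prime i)) / real (nth_prime i)"
          by (rule ln_x_over_x_mono)
        have "real M \<le> a * real i" using i a mult_mono[of 1 a "real M" "real i"] by auto
        then have "ln (real M) \<le> ln (a * real i)" using M1 by (intro ln_mono) auto
        then have "(l\<^sup>2 - l) / (a * real i) \<le> ln (a * real i) / (a * real i)"
          using lnM a by (intro divide_right_mono) auto
        with 1 show "(l\<^sup>2 - l) / a * (1 / real i) \<le> ln (real (nth_prime i)) / real (nth_prime i)"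
          by simp
      qed
      finally show ?thesis by (simp add: mertens_sum_nth_prime_diff[OF MN])
    qed
    also have "\<dots> \<le> ln (real (nth_prime N)) - ln (real (nth_prime M)) + 2 * E"
      using E(2)[of "nth_prime N"] E(2)[of "nth_prime M"] by simp
    also have "\<dots> \<le> l + c"
    proof -
      have "sqrt (real N) \<le> real N" using sqrtM MN by linarith
      then have "real (nth_prime N) < a * real N" using less[of N] by simp
      also have "\<dots> \<le> l\<^sup>2 * real N" using c l8 by (intro mult_right_mono) (auto simp: a_def C_def)
      finally have "ln (real (nth_prime N)) \<le> ln (l\<^sup>2 * real N)" by (intro ln_mono) auto
      also have "\<dots> = ln (l\<^sup>2) + l\<^sup>2" using l8 N_pos by (subst ln_mult_pos) (auto simp: l2)
      finally have 1: "ln (real (nth_prime N)) \<le> ln (l\<^sup>2) + l\<^sup>2" .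
      have "exp (l\<^sup>2 - l) * (l\<^sup>2 / 2) \<le> real M * (ln (real M) - 1)"
      proof (rule mult_mono)
        have "8 * l \<le> l\<^sup>2" using l8 by (simp add: power2_eq_square)
        then show "l\<^sup>2 / 2 \<le> ln (real M) - 1" using lnM l8 by linarith
      qed (use M in auto)
      also have "\<dots> \<le> 4 * real (nth_prime M)" by (rule nth_prime_lower)
      finally have "ln (exp (l\<^sup>2 - l) * (l\<^sup>2 / 8)) \<le> ln (real (nth_prime M))"
        using l8 by (intro ln_mono) auto
      also have "ln (exp (l\<^sup>2 - l) * (l\<^sup>2 / 8)) = l\<^sup>2 - l + (ln (l\<^sup>2) - ln 8)"
        using l8 by (subst ln_mult_pos) (auto simp: ln_div)
      finally show ?thesis using 1 by (simp add: c_def)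
    qed
    finally have "(l\<^sup>2 - l) * (l - 2) \<le> (l + c) * a" using a by (simp add: field_simps)
    moreover have "(l + c) * a = l^3 - 3 * l\<^sup>2 - c * C * l"
      by (simp add: a_def C_def algebra_simps power2_eq_square power3_eq_cube)
    moreover have "(l\<^sup>2 - l) * (l - 2) = l^3 - 3 * l\<^sup>2 + 2 * l"
      by (simp add: algebra_simps power2_eq_square power3_eq_cube)
    moreover have "c * C * l \<ge> 0" using c l8 by (simp add: C_def)
    ultimately show False using l8 by linarith
  qed
  then show ?thesis by blast
qed

text \<open>The mirror image: if \<open>b * i < nth_prime i\<close> for all \<open>i >= N\<close>,
  with \<open>b = l\<^sup>2 + C * l\<close>, the primes are too sparse. From \<open>N\<close> to
  about \<open>N * exp l\<close> the terms \<open>ln p / p\<close> add up to at most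
  \<open>ln (b * M) / b * L\<close>, while Mertens demands \<open>L - c\<close>.\<close>

lemma frequent_small_nth_prime_quotient:
  "\<exists>C N0. \<forall>N\<ge>N0. \<exists>i\<ge>N. 
     real (nth_prime i) \<le> (ln (real N) + C * sqrt (ln (real N))) * real i"
proof -
  obtain E where E: "E \<ge> 0" "\<And>N. N > 0 \<Longrightarrow> \<bar>mertens_sum N - ln (real N)\<bar> \<le> E"
    using mertens by blast
  obtain K where K: "K \<ge> 1" "\<And>n. n \<ge> 2 \<Longrightarrow> real (nth_prime n) \<le> K * real n * ln (real n)"
    using nth_prime_upper by blast
  define c where "c = ln K + 2 * E"
  have c: "c \<ge> 0" using E K by (simp add: c_def)
  \<comment> \<open>The final comparison reads
    \<open>(C - 4) * l\<^sup>2 <= 2 * c * l\<^sup>2\<close>, and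
    \<open>C - 4 = 2 * c + 1\<close>.\<close>
  define C where "C = 2 * c + 5"
  define N0 where "N0 = nat \<lceil>exp ((C + 1)\<^sup>2)\<rceil>"
  have "\<exists>i\<ge>N. real (nth_prime i) \<le> (ln (real N) + C * sqrt (ln (real N))) * real i" if N: "N \<ge> N0" for N
  proof (rule ccontr)
    assume contr: "\<not> (\<exists>i\<ge>N. real (nth_prime i) \<le> (ln (real N) + C * sqrt (ln (real N))) * real i)"
    have N_ge: "exp ((C + 1)\<^sup>2) \<le> real N" using N unfolding N0_def by linarith
    then have N_pos: "real N > 0" using exp_gt_zero[of "(C + 1)\<^sup>2"] by linarith
    have lnN: "(C + 1)\<^sup>2 \<le> ln (real N)" using N_ge N_pos by (simp add: ln_ge_iff)
    define l where "l = sqrt (ln (real N))"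
    have l: "l \<ge> C + 1" unfolding l_def using lnN by (rule real_le_rsqrt)
    have l6: "l \<ge> 6" using l c by (simp add: C_def)
    have "0 \<le> ln (real N)" using lnN zero_le_power2[of "C + 1"] by linarith
    then have l2: "ln (real N) = l\<^sup>2" unfolding l_def by simp
    have N2: "N \<ge> 2"
    proof (rule ccontr)
      assume "\<not> N \<ge> 2"
      then have "N = 1" using N_pos by auto
      then show False using l2 l6 by simp
    qed
    define b where "b = l\<^sup>2 + C * l"
    have less: "b * real i < real (nth_prime i)" if "i \<ge> N" for i
      
    proof (rule ccontr)
      assume "\<not> ?thesis"
      then have "real (nth_prime i) \<le> (ln (real N) + C * sqrt (ln (real N))) * real i"
        unfolding l_def[symmetric] by (simp add: b_def l2)
      with contr that show False by blast
    qed
    have b: "b \<ge> l\<^sup>2" using c l6 by (simp add: b_def C_def)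
    have "36 \<le> l\<^sup>2" using l6 power_mono[of 6 l 2] by simp
    then have b36: "b \<ge> 36" using b by linarith
    define M where "M = nat \<lceil>real N * exp l\<rceil>"
    define L where "L = ln (real M / real N)"
    have "0 \<le> real N * exp l" by simp
    then have M: "real N * exp l \<le> real M" "real M < real N * exp l + 1"
      unfolding M_def by linarith+
    have "real N * 1 \<le> real N * exp l" using l6 by (intro mult_left_mono) auto
    then have MN: "N \<le> M" using M by linarith
    have M_pos: "real M > 0" using MN N2 by simp
    have L: "l \<le> L"
    proof -
      have "exp l \<le> real M / real N" using M N_pos by (simp add: field_simps)
      then show ?thesis unfolding L_def using M_pos N_pos by (subst ln_ge_iff) auto
    qed
    have L_le: "L \<le> l + 1"
    proof -
      have "real M \<le> real N * exp l * 2" using M \<open>real N * 1 \<le> real N * exp l\<close> N2 by linarith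
      also have "\<dots> \<le> real N * exp l * exp 1"
        using exp_ge_add_one_self[of "1::real"] by (intro mult_left_mono) auto
      finally have "real M / real N \<le> exp (l + 1)" using N_pos by (simp add: field_simps exp_add)
      then have "L \<le> ln (exp (l + 1))" unfolding L_def using M_pos N_pos by (intro ln_mono) auto
      then show ?thesis by simp
    qed
    have lnM: "ln (real M) = l\<^sup>2 + L" using M_pos N_pos by (simp add: L_def ln_div l2)
    have ln_bM: "ln (b * real M) = ln b + l\<^sup>2 + L"
      using b36 M_pos by (subst ln_mult_pos) (auto simp: lnM)
    \<comment> \<open>A crude bound suffices: together with \<open>L <= l + 1\<close> it gives
      \<open>ln (b * M)\<close> an excess of \<open>3 * l + C + 1\<close> over
      \<open>l\<^sup>2\<close>, which the term \<open>C * l\<close> of \<open>b\<close>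
      outweighs.\<close>
    have lnb: "ln b \<le> C + 2 * l"
    proof -
      have "l * 1 \<le> l * l" using l6 by (intro mult_left_mono) auto
      then have "C * l \<le> C * l\<^sup>2" using c by (intro mult_left_mono) (auto simp: C_def power2_eq_square)
      then have "b \<le> (1 + C) * l\<^sup>2" by (simp add: b_def algebra_simps)
      then have "ln b \<le> ln ((1 + C) * l\<^sup>2)" using b36 by (intro ln_mono) auto
      also have "\<dots> = ln (1 + C) + 2 * ln l"
        using c l6 by (subst ln_mult_pos) (auto simp: C_def ln_realpow)
      also have "ln (1 + C) \<le> C" using c by (intro ln_add_one_self_le_self) (simp add: C_def)
      also have "ln l \<le> l" using l6 by (intro ln_bound) auto
      finally show ?thesis by simp
    qed
    have "L - c \<le> ln (real (nth_prime M)) - ln (real (nth_prime N)) - 2 * E"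
    proof -
      have "b * real M \<le> real (nth_prime M)" using less[OF MN] by simp
      then have "ln (b * real M) \<le> ln (real (nth_prime M))" using b36 M_pos by (intro ln_mono) auto
      moreover have "ln (real (nth_prime N)) \<le> ln (K * real N * l\<^sup>2)"
        using K(2)[OF N2] by (intro ln_mono) (auto simp: l2)
      moreover have "ln (K * real N * l\<^sup>2) = ln K + l\<^sup>2 + ln (l\<^sup>2)"
        using K(1) N_pos l6 l2 by (simp add: ln_mult)
      moreover have "ln (l\<^sup>2) \<le> ln b" using b l6 by (intro ln_mono) auto
      ultimately show ?thesis by (simp add: ln_bM c_def)
    qed
    also have "\<dots> \<le> mertens_sum (nth_prime M) - mertens_sum (nth_prime N)"
      using E(2)[of "nth_prime N"] E(2)[of "nth_prime M"] by simp
    also have "\<dots> = (\<Sum>i\<in>{N<..M}. ln (real (nth_prime i)) / real (nth_prime i))"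
      by (rule mertens_sum_nth_prime_diff[OF MN])
    also have "\<dots> \<le> (\<Sum>i\<in>{N<..M}. ln (b * real M) / b * (1 / real i))"
    proof (rule sum_mono)
      fix i assume i: "i \<in> {N<..M}"
      then have i1: "real i \<ge> 1" using N2 by simp
      have bi: "b * 1 \<le> b * real i" using b36 i1 by (intro mult_left_mono) auto
      have "ln (real (nth_prime i)) / real (nth_prime i) \<le> ln (b * real i) / (b * real i)"
      proof (rule ln_x_over_x_mono)
        show "exp 1 \<le> b * real i" using bi b36 exp_le by linarith
        show "b * real i \<le> real (nth_prime i)" using less[of i] i by auto
      qed
      also have "\<dots> \<le> ln (b * real M) / (b * real i)"
        using i b36 bi by (intro divide_right_mono ln_mono mult_left_mono) auto
      finally show "ln (real (nth_prime i)) / real (nth_prime i) \<le> ln (b * real M) / b * (1 / real i)" by simp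
    qed
    also have "\<dots> = ln (b * real M) / b * (\<Sum>i\<in>{N<..M}. 1 / real i)"
      by (rule sum_distrib_left [symmetric])
    also have "\<dots> \<le> ln (b * real M) / b * L"
    proof (rule mult_left_mono)
      show "(\<Sum>i\<in>{N<..M}. 1 / real i) \<le> L"
        unfolding L_def using MN N2 by (intro sum_inverse_le) auto
      have "ln b \<ge> 0" using b36 by simp
      then have "ln (b * real M) \<ge> 0" unfolding ln_bM using L l6 by simp
      then show "0 \<le> ln (b * real M) / b" using b36 by simp
    qed
    finally have "(L - c) * b \<le> ln (b * real M) * L" using b36 by (simp add: field_simps)
    also have "\<dots> \<le> (l\<^sup>2 + 3 * l + C + 1) * L"
      using ln_bM lnb L_le L l6 by (intro mult_right_mono) auto
    finally have 1: "L * (C * l - 3 * l - C - 1) \<le> c * b" by (simp add: b_def algebra_simps)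
    have "(C - 4) * l \<le> C * l - 3 * l - C - 1" using l by (simp add: algebra_simps)
    moreover have "0 \<le> (C - 4) * l" using c l6 by (simp add: C_def)
    ultimately have "l * ((C - 4) * l) \<le> L * (C * l - 3 * l - C - 1)"
      using L l6 by (intro mult_mono) auto
    also note 1
    also have "c * b \<le> c * (l * l + l * l)"
      using c l l6 unfolding b_def power2_eq_square
      by (intro mult_left_mono add_left_mono mult_right_mono) auto
    finally have "(2 * c + 1) * (l * l) \<le> 2 * c * (l * l)"
      by (simp add: C_def algebra_simps)
    moreover have "l * l > 0" using l6 by simp
    ultimately show False by (simp add: algebra_simps)
  qed
  then show ?thesis by blast
qed

section \<open>From an interval of skipped quotients to the square-root gap bound\<close>

lemma eventually_nth_prime_gt: "\<exists>n0. \<forall>n\<ge>n0. a * real n < real (nth_prime n)"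
proof -
  define n0 where "n0 = nat \<lceil>exp (4 * \<bar>a\<bar> + 2)\<rceil>"
  have "a * real n < real (nth_prime n)" if "n \<ge> n0" for n
  proof -
    have n: "exp (4 * \<bar>a\<bar> + 2) \<le> real n" using that unfolding n0_def by linarith
    then have pos: "real n > 0" using exp_gt_zero[of "4 * \<bar>a\<bar> + 2"] by linarith
    then have "4 * \<bar>a\<bar> + 2 \<le> ln (real n)" using n by (simp add: ln_ge_iff)
    then have "real n * (4 * a) < real n * (ln (real n) - 1)" using pos by (intro mult_strict_left_mono) auto
    also have "\<dots> \<le> 4 * real (nth_prime n)" by (rule nth_prime_lower)
    finally show ?thesis by (simp add: mult_ac)
  qed
  then show ?thesis by blast
qed

text \<open>While the ratio \<open>nth_prime n / n\<close> stays in \<open>[A, B)\<close>, every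
  window of length \<open>W\<close> adds at least \<open>n\<close> to the prime. After
  \<open>k\<close> windows the gain \<open>k * n\<close> exceeds the available room
  \<open>(B - A) * n + k * B * W\<close>, both summands being at most half of it.\<close>

lemma no_long_run:
  assumes bad: "\<And>n. n \<ge> n0 \<Longrightarrow> A * real n \<le> real (nth_prime n) \<Longrightarrow>
      real (nth_prime n) < B * real n \<Longrightarrow> nth_prime n + n \<le> nth_prime (n + W)"
    and k: "2 * (B - A) \<le> real k" and n: "n \<ge> n0" "2 * B * real W \<le> real n" "n > 0"
  shows "\<exists>j\<le>k * W. real (nth_prime (n + j)) < A * real (n + j) \<or> B * real (n + j) \<le> real (nth_prime (n + j))"
proof (rule ccontr)
  assume contr: "\<not> ?thesis"
  have run: "A * real (n + j) \<le> real (nth_prime (n + j))" "real (nth_prime (n + j)) < B * real (n + j)"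
    if "j \<le> k * W" for j
  proof -
    have "\<not> (real (nth_prime (n + j)) < A * real (n + j) \<or> B * real (n + j) \<le> real (nth_prime (n + j)))"
      using contr that by blast
    then show "A * real (n + j) \<le> real (nth_prime (n + j))" "real (nth_prime (n + j)) < B * real (n + j)"
      by linarith+
  qed
  have grow: "nth_prime n + j * n \<le> nth_prime (n + j * W)" if "j \<le> k" for j
    using that
  proof (induction j)
    case (Suc j)
    have le: "j * W \<le> k * W" using Suc.prems by (intro mult_right_mono) auto
    have "nth_prime (n + j * W) + (n + j * W) \<le> nth_prime (n + j * W + W)"
      using n(1) run[OF le] by (intro bad) auto
    moreover have "n + j * W + W = n + Suc j * W" by simp
    ultimately show ?case using Suc by simp
  qed simp
  have "A * real n + real k * real n \<le> real (nth_prime n + k * n)"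
    using run(1)[of 0] by simp
  also have "\<dots> \<le> real (nth_prime (n + k * W))" using grow[of k] by (intro of_nat_mono) auto
  also have "\<dots> < B * (real n + real k * real W)" using run(2)[of "k * W"] by simp
  finally have 1: "real k * real n < (B - A) * real n + real k * (B * real W)"
    by (simp add: algebra_simps)
  have "real k * (2 * B * real W) \<le> real k * real n" using n by (intro mult_left_mono) auto
  moreover have "2 * (B - A) * real n \<le> real k * real n" using k by (intro mult_right_mono) auto
  ultimately show False using 1 by (simp add: algebra_simps)
qed

text \<open>As primes increase, the ratio can fall from \<open>A + 1\<close> to below
  \<open>A\<close> only over more than \<open>n / A\<close> indices. That is longer than any run
  inside \<open>[A, B)\<close>, so the ratio would have to climb to \<open>B\<close> on the way
  down. The hypothesis \<open>large\<close> will hold because the ratio is only logarithmic in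
  \<open>n\<close>.\<close>

lemma stays_above:
  assumes bad: "\<And>n. n \<ge> n0 \<Longrightarrow> A * real n \<le> real (nth_prime n) \<Longrightarrow>
      real (nth_prime n) < B * real n \<Longrightarrow> nth_prime n + n \<le> nth_prime (n + W)"
    and k: "2 * (B - A) \<le> real k" and AB: "A + 1 \<le> B" "A > 0"
    and large: "\<And>n. n > 0 \<Longrightarrow> A * real n \<le> real (nth_prime n) \<Longrightarrow>
       n \<ge> n0 \<and> 2 * B * real W \<le> real n \<and> A * (real (k * W) + 2) \<le> real n"
    and n: "n > 0" "(A + 1) * real n \<le> real (nth_prime n)" "n \<le> m"
  shows "A * real m \<le> real (nth_prime m)"
proof (rule ccontr)
  assume contr: "\<not> ?thesis"
  define F where "F = (\<lambda>m. m \<ge> n \<and> \<not> A * real m \<le> real (nth_prime m))"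
  define m' where "m' = (LEAST m. F m)"
  have "F m" using contr n(3) by (simp add: F_def)
  then have "F m'" unfolding m'_def by (rule LeastI)
  then have m': "m' \<ge> n" "\<not> A * real m' \<le> real (nth_prime m')" by (simp_all add: F_def)
  have before: "A * real i \<le> real (nth_prime i)" if "n \<le> i" "i < m'" for i
  proof -
    have "\<not> F i" using that(2) unfolding m'_def by (rule not_less_Least)
    then show ?thesis using that(1) by (simp add: F_def)
  qed
  \<comment> \<open>\<open>m'\<close> is the first index where the ratio drops below
    \<open>A\<close>, and \<open>i\<close> the last one before it where the ratio is at least
    \<open>A + 1\<close>.\<close>
  define Q where "Q = (\<lambda>i. i \<ge> n \<and> i \<le> m' \<and> (A + 1) * real i \<le> real (nth_prime i))"
  define i where "i = (GREATEST i. Q i)"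
  have "Q n" using n m' by (simp add: Q_def)
  then have Qi: "Q i" unfolding i_def by (rule GreatestI_nat[where b = m']) (simp add: Q_def)
  have after: "\<not> Q j" if "j > i" for j
  proof
    assume "Q j"
    then have "j \<le> i" unfolding i_def by (rule Greatest_le_nat[where b = m']) (simp add: Q_def)
    with that show False by simp
  qed
  have i: "i \<ge> n" "i > 0" "i < m'"
  proof -
    show "i \<ge> n" "i > 0" using Qi n by (auto simp: Q_def)
    have "A * real i \<le> (A + 1) * real i" by (intro mult_right_mono) auto
    then have "i \<noteq> m'" using Qi m' by (auto simp: Q_def)
    then show "i < m'" using Qi by (simp add: Q_def)
  qed
  have "(A + 1) * real i \<le> real (nth_prime i)" using Qi by (simp add: Q_def)
  also have "\<dots> \<le> real (nth_prime m')" using i by simp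
  also have "\<dots> < A * real m'" using m' by simp
  finally have "real i < A * (real m' - real i)" by (simp add: algebra_simps)
  moreover have li: "i \<ge> n0 \<and> 2 * B * real W \<le> real i \<and> A * (real (k * W) + 2) \<le> real i"
    using i before[of i] by (intro large) auto
  ultimately have "A * (real (k * W) + 2) < A * (real m' - real i)" by linarith
  then have "real (k * W) + 2 < real m' - real i" using AB by (simp add: mult_less_cancel_left)
  then have long: "i + k * W + 2 < m'" by linarith
  \<comment> \<open>The run starting after \<open>i\<close> must leave \<open>[A, B)\<close> before
    \<open>m'\<close>, necessarily upwards; a ratio of at least \<open>B >= A + 1\<close> there
    contradicts the maximality of \<open>i\<close>.\<close>
  have "\<exists>j\<le>k * W. real (nth_prime (Suc i + j)) < A * real (Suc i + j) \<or> B * real (Suc i + j) \<le> real (nth_prime (Suc i + j))"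
  proof (rule no_long_run)
    show "nth_prime n + n \<le> nth_prime (n + W)" if "n \<ge> n0" "A * real n \<le> real (nth_prime n)"
      "real (nth_prime n) < B * real n" for n by (rule bad[OF that])
    show "2 * (B - A) \<le> real k" by (rule k)
    show "Suc i \<ge> n0" "2 * B * real W \<le> real (Suc i)" using li by auto
  qed simp
  then obtain j where j: "j \<le> k * W"
    "real (nth_prime (Suc i + j)) < A * real (Suc i + j) \<or> B * real (Suc i + j) \<le> real (nth_prime (Suc i + j))"
    by blast
  have "A * real (Suc i + j) \<le> real (nth_prime (Suc i + j))" 
    using long j(1) i by (intro before) auto
  with j(2) have "B * real (Suc i + j) \<le> real (nth_prime (Suc i + j))" by linarith
  moreover have "(A + 1) * real (Suc i + j) \<le> B * real (Suc i + j)"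
    using AB by (intro mult_right_mono) auto
  ultimately have "(A + 1) * real (Suc i + j) \<le> real (nth_prime (Suc i + j))" by linarith
  then have "Q (Suc i + j)" using long j(1) i by (simp add: Q_def)
  with after[of "Suc i + j"] show False by simp
qed

text \<open>If no suitable index exists for \<open>t = A\<close>, let \<open>N\<close> be the last
  index with ratio below \<open>A\<close>. Up to \<open>N\<close> the ratio is below
  \<open>A + 1\<close>, and soon after \<open>N\<close> it is at least \<open>B - 1\<close>. The two
  preceding oscillation bounds place both \<open>A\<close> and \<open>B\<close> within
  \<open>O(l)\<close> of \<open>l\<^sup>2 = ln N\<close>, so \<open>B - A\<close> is too small for
  \<open>D\<close>.\<close>

lemma nth_prime_quotient_sqrt_gaps:
  "\<exists>D>0. \<forall>W. \<exists>t0. \<forall>t\<ge>t0. \<exists>n\<ge>W. t \<le> nth_prime n div n \<and>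
     real (nth_prime n div n) \<le> real t + D * sqrt (real t) \<and> nth_prime (n + W) < nth_prime n + n"
proof -
  obtain C1' N1 where C1': "\<And>N. N \<ge> N1 \<Longrightarrow> \<exists>i. sqrt (real N) \<le> real i \<and> i \<le> N \<and>
     (ln (real N) - C1' * sqrt (ln (real N))) * real i \<le> real (nth_prime i)"
    using frequent_large_nth_prime_quotient by blast
  obtain C2' N2 where C2': "\<And>N. N \<ge> N2 \<Longrightarrow> \<exists>i\<ge>N. 
     real (nth_prime i) \<le> (ln (real N) + C2' * sqrt (ln (real N))) * real i"
    using frequent_small_nth_prime_quotient by blast
  obtain K where K: "K \<ge> 1" "\<And>n. n \<ge> 2 \<Longrightarrow> real (nth_prime n) \<le> K * real n * ln (real n)"
    using nth_prime_upper by blast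
  define C1 where "C1 = max 0 C1'"
  define C2 where "C2 = max 0 C2'"
  have C: "C1 \<ge> 0" "C2 \<ge> 0" "C1' \<le> C1" "C2' \<le> C2" by (auto simp: C1_def C2_def)
  \<comment> \<open>The final estimate is \<open>B - A < (3 + C2) + (C1 + C2) * l\<close> with
    \<open>l <= (2 * C1 + 2) * s\<close>; this \<open>D\<close> makes its right side at most
    \<open>D * s\<close>.\<close>
  define D where "D = 3 + C2 + (C1 + C2) * (2 * C1 + 2)"
  have D: "D \<ge> 3" using C by (simp add: D_def)
  have ex: "\<exists>t0. \<forall>t\<ge>t0. \<exists>n\<ge>W. t \<le> nth_prime n div n \<and>
     real (nth_prime n div n) \<le> real t + D * sqrt (real t) \<and> nth_prime (n + W) < nth_prime n + n"
    if W: "W \<ge> 1" for W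
  proof -
    \<comment> \<open>One polynomial majorant for all size requirements. An index with ratio at
      least \<open>t\<close> is at least \<open>exp (t / K)\<close> and hence eventually exceeds
      it.\<close>
    define Y where "Y = (\<lambda>t::real. 20 * real W * t\<^sup>2 + (real W + real N1 + real N2 + 10))"
    have "\<forall>\<^sub>F t in at_top. Y t \<le> exp (t / K)"
    proof -
      have "\<forall>\<^sub>F t in at_top. a * t\<^sup>2 + b \<le> exp (t / K)" for a b :: real
        using K(1) by real_asymp
      then show ?thesis by (simp add: Y_def)
    qed
    then obtain t1 where t1: "\<And>t. t \<ge> t1 \<Longrightarrow> Y t \<le> exp (t / K)"
      by (auto simp: eventually_at_top_linorder)
    \<comment> \<open>\<open>nth_prime 1\<close> ensures that index 1 has ratio below
      \<open>A\<close>, so that \<open>N\<close> exists; \<open>D\<^sup>2\<close> ensures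
      \<open>D <= s\<close> and thereby \<open>B <= 2 * A\<close>.\<close>
    define t0 where "t0 = nat \<lceil>t1\<rceil> + nth_prime 1 + nat \<lceil>D\<^sup>2\<rceil> + 1"
    have "\<exists>n\<ge>W. t \<le> nth_prime n div n \<and>
     real (nth_prime n div n) \<le> real t + D * sqrt (real t) \<and> nth_prime (n + W) < nth_prime n + n"
      if t: "t \<ge> t0" for t
    proof (rule ccontr)
      assume contr: "\<not> (\<exists>n\<ge>W. t \<le> nth_prime n div n \<and>
         real (nth_prime n div n) \<le> real t + D * sqrt (real t) \<and> nth_prime (n + W) < nth_prime n + n)"
      define A where "A = real t"
      define s where "s = sqrt A"
      define B where "B = A + D * s"
      have tt: "real t \<ge> real (nat \<lceil>t1\<rceil>) + real (nth_prime 1) + real (nat \<lceil>D\<^sup>2\<rceil>) + 1"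
        using t unfolding t0_def by linarith
      have A: "A \<ge> t1" "A \<ge> D\<^sup>2" "A > real (nth_prime 1)" "A \<ge> 1"
        using tt real_nat_ceiling_ge[of t1] real_nat_ceiling_ge[of "D\<^sup>2"] unfolding A_def by linarith+
      have s: "s \<ge> D" using A(2) unfolding s_def by (rule real_le_rsqrt)
      have ss: "s * s = A" using A by (simp add: s_def)
      have s1: "s \<ge> 1" using s D by linarith
      have B: "A + 1 \<le> B" "B \<le> 2 * A"
      proof -
        have "1 * 1 \<le> D * s" using D s1 by (intro mult_mono) auto
        then show "A + 1 \<le> B" by (simp add: B_def)
        have "D * s \<le> s * s" using s s1 by (intro mult_right_mono) auto
        then show "B \<le> 2 * A" by (simp add: B_def ss)
      qed
      have bad: "nth_prime n + n \<le> nth_prime (n + W)"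
        if n: "n \<ge> W" "A * real n \<le> real (nth_prime n)" "real (nth_prime n) < B * real n" for n
      proof (rule ccontr)
        assume "\<not> ?thesis"
        moreover have "t \<le> nth_prime n div n"
        proof -
          have "real (t * n) \<le> real (nth_prime n)" using n(2) by (simp add: A_def)
          then have "t * n \<le> nth_prime n" by (simp only: of_nat_le_iff)
          then show ?thesis using n(1) W by (simp add: less_eq_div_iff_mult_less_eq)
        qed
        moreover have "real (nth_prime n div n) \<le> real t + D * sqrt (real t)"
        proof -
          have "real (nth_prime n div n) \<le> real (nth_prime n) / real n" by (rule of_nat_div_le_of_nat)
          also have "\<dots> \<le> B" using n W by (simp add: divide_le_eq)
          finally show ?thesis by (simp add: B_def s_def A_def)
        qed
        ultimately show False using contr n(1) by (meson not_le)
      qed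
      define k where "k = nat \<lceil>2 * (B - A)\<rceil>"
      have k: "2 * (B - A) \<le> real k" "real k \<le> 3 * A"
      proof -
        show "2 * (B - A) \<le> real k" unfolding k_def by (rule real_nat_ceiling_ge)
        have "0 \<le> 2 * (B - A)" using B by simp
        then have "real k < 2 * (B - A) + 1" unfolding k_def by linarith
        then show "real k \<le> 3 * A" using B(2) A(4) by argo
      qed
      have Y: "Y A \<le> real n" if n: "n > 0" "A * real n \<le> real (nth_prime n)" for n
      proof -
        have "n \<ge> 2"
        proof (rule ccontr)
          assume "\<not> n \<ge> 2"
          then have "n = 1" using n by simp
          then show False using n A by simp
        qed
        then have "A * real n \<le> K * real n * ln (real n)" using K(2)[of n] n(2) by linarith
        also have "\<dots> = (K * ln (real n)) * real n" by simp
        finally have "A \<le> K * ln (real n)" by (rule mult_right_le_imp_le) (use n in simp)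
        then have "A / K \<le> ln (real n)" using K(1) by (simp add: divide_le_eq mult_ac)
        then have "exp (A / K) \<le> real n" using n by (simp add: ln_ge_iff)
        with t1[OF A(1)] show ?thesis by linarith
      qed
      have AA: "A \<le> A\<^sup>2" using A by (simp add: power2_eq_square)
      have WA: "real W * A \<le> real W * A\<^sup>2" "A\<^sup>2 \<le> real W * A\<^sup>2"
        using AA W mult_right_mono[of 1 "real W" "A\<^sup>2"] by (auto intro: mult_left_mono)
      have kW: "real (k * W) \<le> 3 * (real W * A)"
        using k mult_right_mono[of "real k" "3 * A" "real W"] by (simp add: mult_ac)
      have AkW: "A * real (k * W) \<le> 3 * (real W * A\<^sup>2)"
        using mult_left_mono[OF kW, of A] A by (simp add: power2_eq_square mult_ac)
      have BkW: "B * real (k * W) \<le> 6 * (real W * A\<^sup>2)"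
        using AkW mult_right_mono[OF B(2), of "real (k * W)"] by simp
      have BW: "2 * B * real W \<le> 4 * (real W * A)"
        using mult_right_mono[OF B(2), of "real W"] by (simp add: mult_ac)
      have YA: "Y A = 20 * (real W * A\<^sup>2) + (real W + real N1 + real N2 + 10)" by (simp add: Y_def)
      have large: "n \<ge> W \<and> 2 * B * real W \<le> real n \<and> A * (real (k * W) + 2) \<le> real n"
        if n: "n > 0" "A * real n \<le> real (nth_prime n)" for n
      proof (intro conjI)
        note Yn = Y[OF n, unfolded YA]
        have "real W \<le> real n" using Yn WA A AA by linarith
        then show "n \<ge> W" by simp
        show "2 * B * real W \<le> real n" using Yn WA A AA BW by linarith
        show "A * (real (k * W) + 2) \<le> real n" unfolding distrib_left using Yn WA A AA AkW by linarith
      qed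
      note above = stays_above[OF bad k(1) B(1) _ large]
      obtain nn where nn: "\<And>n. n \<ge> nn \<Longrightarrow> A * real n < real (nth_prime n)"
        using eventually_nth_prime_gt by blast
      define Q where "Q = (\<lambda>n. n > 0 \<and> real (nth_prime n) < A * real n)"
      define N where "N = (GREATEST n. Q n)"
      have bdd: "Q n \<Longrightarrow> n \<le> nn" for n 
      proof (rule ccontr)
        assume "Q n" "\<not> n \<le> nn"
        then show False using nn[of n] by (simp add: Q_def)
      qed
      have "Q 1" using A by (simp add: Q_def)
      then have QN: "Q N" unfolding N_def using bdd by (rule GreatestI_nat)
      have after: "A * real n \<le> real (nth_prime n)" if "n > N" for n
        
      proof (rule ccontr)
        assume "\<not> ?thesis"
        then have "Q n" using that by (simp add: Q_def)
        then have "n \<le> N" unfolding N_def using bdd by (rule Greatest_le_nat)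
        with that show False by simp
      qed
      \<comment> \<open>A ratio of at least \<open>A + 1\<close> at some \<open>n <= N\<close> would
        keep it at least \<open>A\<close> up to \<open>N\<close>, against the choice of
        \<open>N\<close>.\<close>
      have before: "real (nth_prime n) < (A + 1) * real n" if "n > 0" "n \<le> N" for n
      proof (rule ccontr)
        assume "\<not> ?thesis"
        then have "(A + 1) * real n \<le> real (nth_prime n)" by simp
        then have "A * real N \<le> real (nth_prime N)"
          using that A(4) by (intro above[of n N]) simp_all
        then show False using QN by (simp add: Q_def)
      qed
      \<comment> \<open>The ratio at \<open>N\<close> itself is below \<open>A\<close>, so the size
        bound is applied to \<open>Suc N\<close>.\<close>
      have YN: "20 * (real W * A\<^sup>2) + (real W + real N1 + real N2 + 10) \<le> real N + 1"
      proof -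
        have "Y A \<le> real (Suc N)" by (rule Y) (simp_all only: after lessI zero_less_Suc)
        then show ?thesis unfolding YA by (simp only: of_nat_Suc add.commute)
      qed
      define R where "R = k * W"
      \<comment> \<open>Within the \<open>R\<close> indices before \<open>m\<close> the ratio must
        have reached \<open>B\<close>, since it cannot fall below \<open>A\<close> after
        \<open>N\<close>. Monotonicity carries that prime forward to \<open>m\<close>, and
        \<open>B * R <= m\<close> limits the loss to one unit of the ratio.\<close>
      have far: "(B - 1) * real m \<le> real (nth_prime m)" if m: "m \<ge> N + R + 1" for m
      proof -
        define n where "n = m - R"
        have n: "n > N" "m = n + R" using m by (auto simp: n_def)
        have ln: "n \<ge> W \<and> 2 * B * real W \<le> real n \<and> A * (real (k * W) + 2) \<le> real n"
          using n after[of n] by (intro large) auto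
        have "\<exists>j\<le>k * W. real (nth_prime (n + j)) < A * real (n + j) \<or> B * real (n + j) \<le> real (nth_prime (n + j))"
          using ln n(1) by (intro no_long_run[OF bad k(1)]) auto
        then obtain j where j: "j \<le> k * W" 
          "real (nth_prime (n + j)) < A * real (n + j) \<or> B * real (n + j) \<le> real (nth_prime (n + j))"
          by blast
        then have "B * real (n + j) \<le> real (nth_prime (n + j))"
          using after[of "n + j"] n by auto
        moreover have "real (nth_prime (n + j)) \<le> real (nth_prime m)" using j n by (simp add: R_def)
        moreover have "B * real n \<le> B * real (n + j)" using B A by (intro mult_left_mono) auto
        moreover have "(B - 1) * real m \<le> B * real n"
        proof -
          have "0 \<le> real W * A\<^sup>2" by simp
          then have "6 * (real W * A\<^sup>2) \<le> real N" using YN by linarith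
          moreover have "real N \<le> real m" using m by simp
          ultimately have "B * real R \<le> real m" using BkW unfolding R_def by linarith
          moreover have "real n = real m - real R" using n(2) by simp
          then have "B * real n = B * real m - B * real R" by (simp only: right_diff_distrib)
          moreover have "(B - 1) * real m = B * real m - real m" by (simp only: left_diff_distrib mult_1)
          ultimately show ?thesis by linarith
        qed
        ultimately show ?thesis by linarith
      qed
      have N_big: "N \<ge> N1" "N \<ge> N2" "real R + 1 \<le> real N" "N \<ge> 2"
      proof -
        show "real R + 1 \<le> real N" using YN WA A AA kW unfolding R_def by linarith
        have "real N1 \<le> real N" "real N2 \<le> real N" "2 \<le> real N" using YN WA A AA by linarith+
        then show "N \<ge> N1" "N \<ge> N2" "N \<ge> 2" by linarith+
      qed
      define l where "l = sqrt (ln (real N))"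
      have lnN: "ln (real N) = l\<^sup>2" "l \<ge> 0" using N_big by (simp_all add: l_def)
      have up: "l\<^sup>2 - C1 * l < A + 1"
      proof -
        obtain i where i: "sqrt (real N) \<le> real i" "i \<le> N" 
          "(ln (real N) - C1' * sqrt (ln (real N))) * real i \<le> real (nth_prime i)"
          using C1'[OF N_big(1)] by blast
        have "1 \<le> sqrt (real N)" using N_big by simp
        then have "i > 0" using i(1) by (cases "i = 0") auto
        have "(l\<^sup>2 - C1' * l) * real i \<le> real (nth_prime i)" using i(3) unfolding l_def[symmetric] unfolding lnN(1) .
        also have "\<dots> < (A + 1) * real i" using before[OF \<open>i > 0\<close> i(2)] .
        finally have "l\<^sup>2 - C1' * l < A + 1" using \<open>i > 0\<close> by simp
        moreover have "C1' * l \<le> C1 * l" using C lnN by (intro mult_right_mono) auto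
        ultimately show ?thesis by linarith
      qed
      \<comment> \<open>The second oscillation bound is applied at \<open>N + R + 1\<close>, where
        \<open>far\<close> begins; this is at most \<open>2 * N\<close>, so its logarithm exceeds
        \<open>l\<^sup>2\<close> by less than 1.\<close>
      have down: "B - 1 \<le> l\<^sup>2 + 1 + C2 * (l + 1)"
      proof -
        define M where "M = N + R + 1"
        have M: "M \<ge> N2" "real M \<le> 2 * real N" "M \<ge> 2" using N_big by (auto simp: M_def)
        obtain i where i: "i \<ge> M" "real (nth_prime i) \<le> (ln (real M) + C2' * sqrt (ln (real M))) * real i"
          using C2'[OF M(1)] by blast
        have "(B - 1) * real i \<le> real (nth_prime i)" using i(1) by (intro far) (simp add: M_def)
        also note i(2)
        finally have "B - 1 \<le> ln (real M) + C2' * sqrt (ln (real M))" using i(1) M by simp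
        moreover have lnM: "ln (real M) \<le> l\<^sup>2 + 1"
        proof -
          have "ln (real M) \<le> ln (2 * real N)" using M by (intro ln_mono) auto
          also have "\<dots> = ln 2 + l\<^sup>2" using N_big by (subst ln_mult_pos) (auto simp: lnN)
          finally show ?thesis using ln_2_less_1 by linarith
        qed
        moreover have "C2' * sqrt (ln (real M)) \<le> C2 * (l + 1)"
        proof (rule mult_mono)
          have "ln (real M) \<le> (l + 1)\<^sup>2" using lnM lnN(2) by (simp add: power2_sum)
          then show "sqrt (ln (real M)) \<le> l + 1" using lnN(2) by (intro real_le_lsqrt) auto
        qed (use C M in auto)
        ultimately show ?thesis by linarith
      qed
      \<comment> \<open>The inequality \<open>up\<close> converts errors measured in
        \<open>l\<close> into errors measured in \<open>s = sqrt A\<close>.\<close>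
      have "l \<le> 2 * C1 + 2 * s"
      proof (rule ccontr)
        assume "\<not> ?thesis"
        then have l: "l > 2 * C1 + 2 * s" by simp
        have "(2 * s) * (2 * s) \<le> l * l" using l C s1 by (intro mult_mono) auto
        moreover have "2 * C1 * l \<le> l * l" using l C s1 lnN(2) by (intro mult_right_mono) auto
        moreover have "(2 * s) * (2 * s) = 4 * A" using ss by simp
        moreover have "2 * (l\<^sup>2 - C1 * l) = 2 * (l * l) - 2 * C1 * l" by (simp add: power2_eq_square)
        ultimately have "4 * A \<le> 2 * (l\<^sup>2 - C1 * l)" by linarith
        also have "\<dots> < 2 * (A + 1)" using up by (intro mult_strict_left_mono) auto
        finally show False using A(4) by simp
      qed
      then have "(C1 + C2) * l \<le> (C1 + C2) * (2 * C1 + 2 * s)" using C by (intro mult_left_mono) auto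
      also have "\<dots> \<le> (C1 + C2) * ((2 * C1 + 2) * s)"
      proof -
        have "2 * C1 * 1 \<le> 2 * C1 * s" using C s1 by (intro mult_left_mono) auto
        then have "2 * C1 + 2 * s \<le> (2 * C1 + 2) * s" unfolding distrib_right by linarith
        then show ?thesis using C by (intro mult_left_mono) auto
      qed
      finally have 1: "(C1 + C2) * l \<le> (C1 + C2) * (2 * C1 + 2) * s" by (simp only: mult.assoc)
      have 2: "3 + C2 \<le> (3 + C2) * s" using C s1 mult_left_mono[of 1 s "3 + C2"] by simp
      have "C2 * (l + 1) = C2 * l + C2" "(C1 + C2) * l = C1 * l + C2 * l" by (simp_all add: algebra_simps)
      then have "B - A < (3 + C2) + (C1 + C2) * l" using up down by linarith
      also have "\<dots> \<le> (3 + C2) * s + (C1 + C2) * (2 * C1 + 2) * s" by (rule add_mono[OF 2 1])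
      also have "\<dots> = D * s" by (simp add: D_def algebra_simps)
      finally have "B - A < D * s" .
      then show False by (simp add: B_def)
    qed
    then show ?thesis by blast
  qed
  \<comment> \<open>The window length 0 is obtained from a longer one: each \<open>W\<close> is
    deduced from \<open>Suc W\<close>, since primes increase.\<close>
  have "\<exists>t0. \<forall>t\<ge>t0. \<exists>n\<ge>W. t \<le> nth_prime n div n \<and>
     real (nth_prime n div n) \<le> real t + D * sqrt (real t) \<and> nth_prime (n + W) < nth_prime n + n" for W
  proof -
    obtain t0 where t0: "\<And>t. t \<ge> t0 \<Longrightarrow> \<exists>n\<ge>Suc W. t \<le> nth_prime n div n \<and>
     real (nth_prime n div n) \<le> real t + D * sqrt (real t) \<and> nth_prime (n + Suc W) < nth_prime n + n"
      using ex[of "Suc W"] by auto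
    have mono: "nth_prime (n + W) \<le> nth_prime (n + Suc W)" for n by simp
    show ?thesis
    proof (rule exI[of _ t0], intro allI impI)
      fix t assume "t \<ge> t0"
      from t0[OF this] obtain n where n: "n \<ge> Suc W" "t \<le> nth_prime n div n"
        "real (nth_prime n div n) \<le> real t + D * sqrt (real t)" "nth_prime (n + Suc W) < nth_prime n + n"
        by blast
      have "nth_prime (n + W) < nth_prime n + n" using mono[of n] n(4) by linarith
      with n show "\<exists>n\<ge>W. t \<le> nth_prime n div n \<and>
         real (nth_prime n div n) \<le> real t + D * sqrt (real t) \<and> nth_prime (n + W) < nth_prime n + n"
        using Suc_leD by blast
    qed
  qed
  moreover have "D > 0" using D by simp
  ultimately show ?thesis by blast
qed

section \<open>Representing a number by quotients\<close>

text \<open>Choose \<open>J + 1\<close> distinct elements \<open>a j\<close> of \<open>G\<close> of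
  order \<open>M ^ 4\<close>. Approximating \<open>x * a j\<close> by \<open>b j\<close> in
  \<open>G\<close> leaves a remainder of order \<open>M\<^sup>2\<close>, and approximating that by
  \<open>c j\<close> in \<open>G\<close> leaves an error of order \<open>M\<close>. There are fewer
  possible errors than indices, so two errors agree; subtracting the two relations gives the
  representation.\<close>

lemma quotient_representation:
  fixes G :: "nat set" and D :: real
  assumes "\<exists>t0. \<forall>t\<ge>t0. \<exists>K\<in>G. t \<le> K \<and> real K \<le> real t + D * sqrt (real t)"
  shows "\<exists>K1\<in>G. \<exists>K2\<in>G. \<exists>K3\<in>G. \<exists>K4\<in>G. \<exists>K5\<in>G. \<exists>K6\<in>G.
    K5 \<noteq> K6 \<and> x * K5 + K3 + K4 = x * K6 + K1 + K2"
proof -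
  obtain t0 where t0: "\<And>t. t \<ge> t0 \<Longrightarrow> \<exists>K\<in>G. t \<le> K \<and> real K \<le> real t + D * sqrt (real t)"
    using assms by blast
  then obtain k where k: "\<And>t. t \<ge> t0 \<Longrightarrow> k t \<in> G" "\<And>t. t \<ge> t0 \<Longrightarrow> t \<le> k t"
    "\<And>t. t \<ge> t0 \<Longrightarrow> real (k t) \<le> real t + D * sqrt (real t)"
    by metis
  define d where "d = nat \<lceil>D\<rceil> + 1"
  have d: "d \<ge> 1" "D \<le> real d" unfolding d_def using real_nat_ceiling_ge[of D] by auto
  have k_le: "k t \<le> t + d * r" if "t \<ge> t0" "t \<le> r\<^sup>2" for t r
  proof -
    have "real t \<le> (real r)\<^sup>2" using that(2) by (metis of_nat_le_iff of_nat_power)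
    then have "sqrt (real t) \<le> real r" by (intro real_le_lsqrt) auto
    then have "D * sqrt (real t) \<le> real d * real r" using d by (intro mult_mono) auto
    with k(3)[OF that(1)] have "real (k t) \<le> real t + real d * real r" by linarith
    also have "\<dots> = real (t + d * r)" by simp
    finally show ?thesis by (simp only: of_nat_le_iff)
  qed
  show ?thesis
  proof (cases "x = 0")
    case True
    \<comment> \<open>For \<open>x = 0\<close> any two distinct elements serve as \<open>K5\<close>
      and \<open>K6\<close>, and the other four can be made to cancel.\<close>
    have "k t0 \<noteq> k (Suc (k t0))" using k(2)[of t0] k(2)[of "Suc (k t0)"] by simp
    moreover have "k t0 \<in> G" "k (Suc (k t0)) \<in> G" using k(1) k(2)[of t0] by auto
    ultimately show ?thesis using True by (metis mult_0)
  next
    case False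
    then have x: "x \<ge> 1" by simp
    \<comment> \<open>Exceeding \<open>12 * x * d ^ 3\<close> is what the pigeonhole count
      \<open>d * r < J\<close> requires; the summand \<open>t0\<close> keeps every argument of
      \<open>k\<close> above the threshold.\<close>
    define m where "m = 12 * x * d ^ 3 + t0 + 1"
    define M where "M = d * m"
    define J where "J = d * m\<^sup>2"
    \<comment> \<open>Larger than the gap bound \<open>d * (2 * M\<^sup>2)\<close> at the heights
      \<open>t j <= (2 * M\<^sup>2)\<^sup>2\<close>, so the chosen elements are strictly
      increasing.\<close>
    define s where "s = 2 * d * M\<^sup>2 + 1"
    \<comment> \<open>\<open>q\<^sup>2\<close> bounds every \<open>x * a j\<close>, hence
      \<open>d * q\<close> bounds the gaps up to that height.\<close>
    define q where "q = 6 * x * d * M\<^sup>2"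
    have m1: "m \<ge> 1" by (simp add: m_def)
    have M1: "M \<ge> 1" using d m1 by (simp add: M_def)
    have M2: "M \<le> M\<^sup>2" using M1 by (simp add: power2_eq_square)
    have mM: "m \<le> M" using d by (simp add: M_def)
    have "12 * x * d\<^sup>2 * 1 \<le> 12 * x * d\<^sup>2 * d" using d by (intro mult_left_mono) auto
    moreover have "12 * x * d\<^sup>2 * d = 12 * x * d ^ 3" by (simp add: power2_eq_square power3_eq_cube)
    ultimately have M_big: "12 * x * d\<^sup>2 + t0 \<le> M\<^sup>2" using mM M2 unfolding m_def by linarith
    have M4_eq: "M\<^sup>2 * M\<^sup>2 = M ^ 4" by (simp flip: power_add)
    have "(12 * x * d\<^sup>2 + t0) * M\<^sup>2 \<le> M\<^sup>2 * M\<^sup>2" using M_big by (rule mult_right_mono) simp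
    moreover have "t0 * 1 \<le> t0 * M\<^sup>2" using M1 by (intro mult_left_mono) auto
    ultimately have M4: "12 * x * d\<^sup>2 * M\<^sup>2 + t0 \<le> M ^ 4"
      unfolding M4_eq add_mult_distrib by linarith
    have "s \<le> 3 * d * M\<^sup>2"
    proof -
      have "1 * 1 \<le> d * M\<^sup>2" using d M1 by (intro mult_mono) auto
      then show ?thesis by (simp add: s_def)
    qed
    then have "J * s \<le> J * (3 * d * M\<^sup>2)" by (rule mult_left_mono) simp
    also have "\<dots> = 3 * (M\<^sup>2 * M\<^sup>2)" by (simp add: J_def M_def power2_eq_square)
    finally have Js: "J * s \<le> 3 * M ^ 4" by (simp flip: power_add)
    define t where "t = (\<lambda>j. M ^ 4 + j * s)"
    have t: "t0 \<le> t j" "M ^ 4 \<le> t j" "t j \<le> (2 * M\<^sup>2)\<^sup>2" if "j \<le> J" for j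
    proof -
      show "M ^ 4 \<le> t j" by (simp add: t_def)
      then show "t0 \<le> t j" using M4 by linarith
      have "j * s \<le> J * s" using that by (rule mult_right_mono) simp
      then have "t j \<le> 4 * M ^ 4" using Js unfolding t_def by linarith
      then show "t j \<le> (2 * M\<^sup>2)\<^sup>2" by (simp add: power_mult_distrib flip: power_mult)
    qed
    define a where "a = (\<lambda>j. k (t j))"
    have a_le: "a j \<le> t j + d * (2 * M\<^sup>2)" if "j \<le> J" for j
      unfolding a_def using t[OF that] by (intro k_le)
    have a_ge: "t j \<le> a j" if "j \<le> J" for j
      unfolding a_def using t[OF that] by (intro k(2))
    have a_less: "a i < a j" if "i < j" "j \<le> J" for i j
    proof -
      have "a i < t i + s" using a_le[of i] that by (simp add: s_def)
      also have "\<dots> = t (Suc i)" by (simp add: t_def)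
      also have "\<dots> \<le> t j" unfolding t_def using that by (intro add_left_mono mult_right_mono) auto
      also have "\<dots> \<le> a j" using a_ge that by simp
      finally show ?thesis .
    qed
    have xa: "M ^ 4 \<le> x * a j" "x * a j \<le> q\<^sup>2" if "j \<le> J" for j
    proof -
      have "1 * M ^ 4 \<le> x * a j" using x t(2)[OF that] a_ge[OF that] by (intro mult_mono) auto
      then show "M ^ 4 \<le> x * a j" by simp
      have "d * (2 * M\<^sup>2) \<le> 2 * (d * M ^ 4)"
        using M1 power_increasing[of 2 4 M] by simp
      moreover have "t j \<le> 4 * (d * M ^ 4)"
      proof -
        have "t j \<le> 4 * M ^ 4" using t(3)[OF that] by (simp add: power_mult_distrib flip: power_mult)
        also have "\<dots> \<le> 4 * (d * M ^ 4)" using d by simp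
        finally show ?thesis .
      qed
      ultimately have "a j \<le> 6 * (d * M ^ 4)" using a_le[OF that] by linarith
      then have "x * a j \<le> x * (6 * (d * M ^ 4))" by (rule mult_left_mono) simp
      also have "\<dots> = 6 * x * d * M ^ 4" by simp
      also have "\<dots> \<le> (6 * x * d) * (6 * x * d) * M ^ 4"
        using x d by (intro mult_right_mono) auto
      also have "\<dots> = q\<^sup>2" by (simp add: q_def power2_eq_square power4_eq_xxxx mult_ac)
      finally show "x * a j \<le> q\<^sup>2" .
    qed
    \<comment> \<open>Aiming \<open>2 * d * q\<close> too low places \<open>b j\<close> between
      \<open>d * q\<close> and \<open>2 * d * q\<close> below \<open>x * a j\<close>: the remainder
      is large enough to be approximated again, yet only of order \<open>M\<^sup>2\<close>.\<close>
    define b where "b = (\<lambda>j. k (x * a j - 2 * d * q))"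
    have dq: "2 * d * q = 12 * x * d\<^sup>2 * M\<^sup>2" by (simp add: q_def power2_eq_square)
    have b: "b j \<in> G" "x * a j \<le> b j + 2 * d * q" "b j + d * q \<le> x * a j" if "j \<le> J" for j
    proof -
      have big: "2 * d * q + t0 \<le> x * a j" unfolding dq using M4 xa(1)[OF that] by linarith
      then have ge: "t0 \<le> x * a j - 2 * d * q" by linarith
      show "b j \<in> G" unfolding b_def by (rule k(1)[OF ge])
      show "x * a j \<le> b j + 2 * d * q" unfolding b_def using k(2)[OF ge] by linarith
      have "b j \<le> x * a j - 2 * d * q + d * q"
        unfolding b_def using xa(2)[OF that] by (intro k_le[OF ge]) simp
      then show "b j + d * q \<le> x * a j" using big by simp
    qed
    define c where "c = (\<lambda>j. k (x * a j - b j))"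
    \<comment> \<open>\<open>r\<^sup>2\<close> bounds \<open>2 * d * q\<close>, so
      \<open>d * r\<close> bounds the gap in the second approximation.\<close>
    define r where "r = 12 * x * d\<^sup>2 * M"
    have c: "c j \<in> G" "x * a j \<le> b j + c j" "b j + c j \<le> x * a j + d * r" if "j \<le> J" for j
    proof -
      have "t0 \<le> M\<^sup>2" using M_big by linarith
      also have "1 * (1 * M\<^sup>2) \<le> d * ((6 * x * d) * M\<^sup>2)" using d x by (intro mult_mono) auto
      then have "M\<^sup>2 \<le> d * q" by (simp add: q_def)
      also have "d * q \<le> x * a j - b j" using b(3)[OF that] by linarith
      finally have ge: "t0 \<le> x * a j - b j" .
      show "c j \<in> G" unfolding c_def by (rule k(1)[OF ge])
      show "x * a j \<le> b j + c j" unfolding c_def using k(2)[OF ge] by linarith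
      have "x * a j - b j \<le> 2 * d * q" using b(2)[OF that] by linarith
      also have "\<dots> = (12 * x * d\<^sup>2) * 1 * M\<^sup>2" unfolding dq by simp
      also have "\<dots> \<le> (12 * x * d\<^sup>2) * (12 * x * d\<^sup>2) * M\<^sup>2"
        using x d by (intro mult_right_mono mult_left_mono) auto
      also have "\<dots> = r\<^sup>2" by (simp add: r_def power2_eq_square mult_ac)
      finally have "c j \<le> x * a j - b j + d * r" unfolding c_def by (rule k_le[OF ge])
      moreover have "b j \<le> x * a j" using b(3)[OF that] by linarith
      ultimately show "b j + c j \<le> x * a j + d * r" by linarith
    qed
    define e where "e = (\<lambda>j. b j + c j - x * a j)"
    \<comment> \<open>The errors lie in \<open>{0..d * r}\<close> with \<open>d * r\<close> linear
      in \<open>m\<close>, against the \<open>d * m\<^sup>2 + 1\<close> indices.\<close>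
    have "\<not> inj_on e {..J}"
    proof (rule pigeonhole)
      have "e ` {..J} \<subseteq> {..d * r}" using c by (fastforce simp: e_def)
      then have "card (e ` {..J}) \<le> card {..d * r}" by (intro card_mono) auto
      also have "\<dots> = d * r + 1" by simp
      also have "d * r = d * (12 * x * d ^ 3) * m"
        by (simp add: r_def M_def power2_eq_square power3_eq_cube mult_ac)
      also have "\<dots> < d * m * m"
        using d m1 by (intro mult_strict_right_mono mult_strict_left_mono) (auto simp: m_def)
      finally have "card (e ` {..J}) < J + 1" by (simp add: J_def power2_eq_square mult_ac)
      then show "card (e ` {..J}) < card {..J}" by simp
    qed
    then obtain i j where ij: "i \<le> J" "j \<le> J" "i \<noteq> j" "e i = e j" by (auto simp: inj_on_def)
    have ne: "a i \<noteq> a j" using a_less[of i j] a_less[of j i] ij by (cases "i < j") auto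
    have aG: "a i \<in> G" "a j \<in> G" unfolding a_def using t(1) ij by (auto intro: k(1))
    have "b i + c i = e i + x * a i" "b j + c j = e j + x * a j"
      using c(2)[OF ij(1)] c(2)[OF ij(2)] by (auto simp: e_def)
    then have "x * a j + b i + c i = x * a i + b j + c j" using ij(4) by simp
    then show ?thesis
      using ne aG b(1)[OF ij(1)] b(1)[OF ij(2)] c(1)[OF ij(1)] c(1)[OF ij(2)] by metis
  qed
qed

section \<open>Multiplication by a quotient\<close>

definition prime_quotient :: "nat \<Rightarrow> nat" where
  "prime_quotient n = nth_prime n div n"

lemma nth_prime_decomp: "n > 0 \<Longrightarrow> nth_prime n = n * prime_quotient n + prime_rem r0 n"
  by (simp add: prime_quotient_def prime_rem_def)

text \<open>The quotient is logarithmic in \<open>n\<close>. This makes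
  \<open>w * prime_quotient n < n\<close> follow from \<open>w <= prime_quotient n\<close>.\<close>

lemma prime_quotient_square_less: "\<exists>n0>0. \<forall>n\<ge>n0. prime_quotient n * prime_quotient n < n"
proof -
  obtain C where C: "C \<ge> 1" "\<And>n. n \<ge> 2 \<Longrightarrow> real (nth_prime n) \<le> C * real n * ln (real n)"
    using nth_prime_upper by blast
  have "\<forall>\<^sub>F n in sequentially. (C * ln (real n)) * (C * ln (real n)) < real n"
    using C(1) by real_asymp
  then obtain n1 where n1: "\<And>n. n \<ge> n1 \<Longrightarrow> (C * ln (real n)) * (C * ln (real n)) < real n"
    by (auto simp: eventually_sequentially)
  have "prime_quotient n * prime_quotient n < n" if n: "n \<ge> n1 + 2" for n
  proof -
    have "real (prime_quotient n) \<le> real (nth_prime n) / real n"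
      unfolding prime_quotient_def by (rule of_nat_div_le_of_nat)
    also have "\<dots> \<le> C * ln (real n)" using C(2)[of n] n by (simp add: divide_le_eq mult_ac)
    finally have "real (prime_quotient n) * real (prime_quotient n) \<le> (C * ln (real n)) * (C * ln (real n))"
      by (intro mult_mono) auto
    also have "\<dots> < real n" using n1[of n] n by simp
    finally show ?thesis by (simp flip: of_nat_mult)
  qed
  then show ?thesis by (intro exI[of _ "n1 + 2"]) auto
qed

text \<open>The three cases say that \<open>v\<close> is \<open>(n + w) * q' - n * q + j * (n + w)\<close> with
  \<open>j \<in> {0, 1, -1}\<close>, where \<open>q\<close> and \<open>q'\<close> are the quotients at \<open>n\<close> and at \<open>n + w\<close>; such a \<open>v\<close> is congruent to
  \<open>w * q\<close> modulo \<open>n + w\<close>.\<close>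

definition shift_rel :: "nat \<Rightarrow> nat \<Rightarrow> nat \<Rightarrow> nat \<Rightarrow> bool" where
  "shift_rel r0 n w v \<longleftrightarrow>
     nth_prime (n + w) + prime_rem r0 n = v + nth_prime n + prime_rem r0 (n + w) \<or>
     nth_prime (n + w) + prime_rem r0 n + (n + w) = v + nth_prime n + prime_rem r0 (n + w) \<or>
     nth_prime (n + w) + prime_rem r0 n = v + nth_prime n + prime_rem r0 (n + w) + (n + w)"

lemma shift_rel_iff:
  assumes "n > 0"
  shows "shift_rel r0 n w v \<longleftrightarrow>
    (n + w) * prime_quotient (n + w) = v + n * prime_quotient n \<or>
    (n + w) * (prime_quotient (n + w) + 1) = v + n * prime_quotient n \<or>
    (n + w) * prime_quotient (n + w) = v + n * prime_quotient n + (n + w)"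
  using nth_prime_decomp[of n r0] nth_prime_decomp[of "n + w" r0] assms
  unfolding shift_rel_def by auto

lemma mult_eq_small_imp_zero:
  fixes N c d :: int
  assumes "N * c = d" "\<bar>d\<bar> < N"
  shows "d = 0"
proof (rule ccontr)
  assume "d \<noteq> 0"
  then have "c \<noteq> 0" using assms by auto
  then have "N * 1 \<le> N * \<bar>c\<bar>" using assms(2) by (intro mult_left_mono) auto
  also have "\<dots> = \<bar>d\<bar>" 
  proof -
    have "N > 0" using assms(2) abs_ge_zero[of d] by linarith
    then show ?thesis unfolding assms(1)[symmetric] abs_mult by simp
  qed
  finally show False using assms(2) by simp
qed

text \<open>All three cases make \<open>v\<close> congruent to \<open>w * prime_quotient n\<close>
  modulo \<open>n + w\<close>; both numbers are below \<open>n\<close>, so they coincide.\<close>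

lemma shift_rel_sound:
  assumes "shift_rel r0 n w v" "v < n" "w * prime_quotient n < n"
  shows "v = w * prime_quotient n"
proof -
  define q q' where "q = prime_quotient n" and "q' = prime_quotient (n + w)"
  have "n > 0" using assms by simp
  then consider "(n + w) * q' = v + n * q" | "(n + w) * (q' + 1) = v + n * q" 
    | "(n + w) * q' = v + n * q + (n + w)"
    using assms(1) by (auto simp: shift_rel_iff q_def q'_def)
  then obtain j :: int where "int (n + w) * (int q' + j) = int v + int n * int q"
  proof cases
    case 1
    then show ?thesis using that[of 0] by (simp flip: of_nat_add of_nat_mult)
  next
    case 2
    then have "int ((n + w) * (q' + 1)) = int (v + n * q)" by simp
    then show ?thesis using that[of 1] by (simp add: algebra_simps)
  next
    case 3
    then have "int ((n + w) * q') = int (v + n * q + (n + w))" by simp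
    then show ?thesis using that[of "-1"] by (simp add: algebra_simps)
  qed
  then have "int (n + w) * (int q' + j - int q) = int v - int (w * q)"
    by (simp add: algebra_simps)
  moreover have "\<bar>int v - int (w * q)\<bar> < int (n + w)"
    using assms(2,3) unfolding q_def by linarith
  ultimately have "int v - int (w * q) = 0" by (rule mult_eq_small_imp_zero)
  then show ?thesis unfolding q_def by linarith
qed

text \<open>The quotients at \<open>n\<close> and \<open>n + w\<close> differ by at most one: the
  prime grows by less than \<open>n\<close>, which bounds \<open>q'\<close> above, and it does not
  decrease while \<open>w * q < n\<close>, which bounds \<open>q'\<close> below. The three
  possibilities are the three cases of \<open>shift_rel\<close>.\<close>

lemma shift_rel_complete:
  assumes n: "n > 0" "w * prime_quotient n < n" and less: "nth_prime (n + w) < nth_prime n + n"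
  shows "shift_rel r0 n w (w * prime_quotient n)"
proof -
  define q q' where "q = prime_quotient n" and "q' = prime_quotient (n + w)"
  have P: "nth_prime n = n * q + prime_rem r0 n" and r: "prime_rem r0 n < n"
    using nth_prime_decomp[OF n(1)] n(1) by (simp_all add: q_def prime_rem_def)
  have P': "nth_prime (n + w) = (n + w) * q' + prime_rem r0 (n + w)" and r': "prime_rem r0 (n + w) < n + w"
    using nth_prime_decomp[of "n + w"] n(1) by (simp_all add: q'_def prime_rem_def)
  have "(n + w) * q' < n * q + n + n" using less P r P' by linarith
  also have "\<dots> = n * (q + 2)" by simp
  also have "\<dots> \<le> (n + w) * (q + 2)" by (rule mult_right_mono) auto
  finally have 1: "q' < q + 2" by (simp only: mult_less_cancel1)
  have "nth_prime n \<le> nth_prime (n + w)" by simp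
  then have "n * q < (n + w) * q' + (n + w)" using P P' r' by linarith
  then have "n * q < (n + w) * (q' + 1)" by simp
  moreover have "(n + w) * q = n * q + w * q" by (rule add_mult_distrib)
  ultimately have "(n + w) * q < (n + w) * (q' + 1) + n" using n(2) unfolding q_def by linarith
  also have "\<dots> \<le> (n + w) * (q' + 2)" by simp
  finally have 2: "q < q' + 2" by (simp only: mult_less_cancel1)
  from 1 2 consider "q' = q" | "q = q' + 1" | "q' = q + 1" by linarith
  then have "(n + w) * q' = w * q + n * q \<or> (n + w) * (q' + 1) = w * q + n * q \<or>
    (n + w) * q' = w * q + n * q + (n + w)"
    by cases (simp_all add: algebra_simps)
  then show ?thesis unfolding shift_rel_iff[OF n(1)] q_def q'_def .
qed

text \<open>The instance of \<open>shift_rel\<close> with shift 1 forces \<open>K\<close> to be the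
  quotient at \<open>n\<close>, so that no quotient symbol is needed. \<open>K < n\<close> also
  keeps the index positive, so the arbitrary value \<open>r0\<close> never enters.\<close>

definition product_witness :: "nat \<Rightarrow> nat \<Rightarrow> nat \<Rightarrow> nat \<Rightarrow> nat \<Rightarrow> nat \<Rightarrow> bool" where
  "product_witness r0 n0 n K w v \<longleftrightarrow>
     n0 \<le> n \<and> K < n \<and> v < n \<and> w \<le> K \<and> shift_rel r0 n 1 K \<and> shift_rel r0 n w v"

lemma product_witness_sound:
  assumes "\<And>n. n \<ge> n0 \<Longrightarrow> prime_quotient n * prime_quotient n < n"
    and "product_witness r0 n0 n K w v"
  shows "v = w * K"
proof -
  have n: "n0 \<le> n" "K < n" "v < n" "w \<le> K" "shift_rel r0 n 1 K" "shift_rel r0 n w v"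
    using assms(2) by (auto simp: product_witness_def)
  note sq = assms(1)[OF n(1)]
  have "prime_quotient n \<le> prime_quotient n * prime_quotient n" by (rule le_square)
  then have "1 * prime_quotient n < n" using sq by linarith
  then have K: "K = prime_quotient n" using shift_rel_sound[OF n(5,2)] by simp
  have "w * prime_quotient n \<le> prime_quotient n * prime_quotient n"
    using n(4) K by (intro mult_right_mono) auto
  then have "w * prime_quotient n < n" using sq by linarith
  then show ?thesis using shift_rel_sound[OF n(6,3)] K by simp
qed

text \<open>One window of length \<open>W\<close> covers both the shift 1 and the shift
  \<open>w\<close>, because primes increase.\<close>

lemma product_witness_complete:
  assumes "\<And>n. n \<ge> n0 \<Longrightarrow> prime_quotient n * prime_quotient n < n" 
    and n: "n0 \<le> n" "w \<le> prime_quotient n" "w \<le> W" "1 \<le> W"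
    and less: "nth_prime (n + W) < nth_prime n + n"
  shows "product_witness r0 n0 n (prime_quotient n) w (w * prime_quotient n)"
proof -
  note sq = assms(1)[OF n(1)]
  have "prime_quotient n \<le> prime_quotient n * prime_quotient n" by (rule le_square)
  then have K: "prime_quotient n < n" using sq by linarith
  have "w * prime_quotient n \<le> prime_quotient n * prime_quotient n"
    using n(2) by (intro mult_right_mono) auto
  then have v: "w * prime_quotient n < n" using sq by linarith
  have less': "nth_prime (n + u) < nth_prime n + n" if "u \<le> W" for u
  proof -
    have "nth_prime (n + u) \<le> nth_prime (n + W)" using that by simp
    then show ?thesis using less by linarith
  qed
  have "n > 0" using K by simp
  then have "shift_rel r0 n 1 (prime_quotient n)" "shift_rel r0 n w (w * prime_quotient n)"
    using shift_rel_complete[of n 1 r0] shift_rel_complete[of n w r0] K v less'[OF n(4)] less'[OF n(3)]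
    by simp_all
  then show ?thesis using n K v by (simp add: product_witness_def)
qed

text \<open>The eight products are \<open>y * k 0\<close> to \<open>y * k 3\<close>,
  \<open>x * k 4\<close>, \<open>x * k 5\<close>, \<open>z * k 4\<close> and \<open>z * k 5\<close>.
  The linear equations express \<open>x * (k 4 - k 5)\<close> by \<open>k 0\<close> to
  \<open>k 3\<close>, and \<open>z * (k 4 - k 5)\<close> as \<open>y\<close> times the same
  expression; \<open>k 4 - k 5\<close> then cancels.\<close>

lemma mult_iff_product_witnesses:
  assumes n0: "\<And>n. n \<ge> n0 \<Longrightarrow> prime_quotient n * prime_quotient n < n"
  shows "z = x * y \<longleftrightarrow> (\<exists>k v n. 
     (\<forall>c<8. product_witness r0 n0 (n c) (k ([0,1,2,3,4,5,4,5::nat] ! c)) ([y,y,y,y,x,x,z,z] ! c) (v c)) \<and>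
     k 4 \<noteq> k 5 \<and> v 4 + k 2 + k 3 = v 5 + k 0 + k 1 \<and> v 6 + v 2 + v 3 = v 7 + v 0 + v (1::nat))"
    (is "_ \<longleftrightarrow> (\<exists>k v n. ?R k v n)")
proof
  assume "\<exists>k v n. ?R k v n"
  then obtain k v n where R: "?R k v n" by blast
  have "v c = [y,y,y,y,x,x,z,z] ! c * k ([0,1,2,3,4,5,4,5] ! c)" if "c < 8" for c
    using R that product_witness_sound[OF n0] by blast
  from this[of 0] this[of 1] this[of 2] this[of 3] this[of 4] this[of 5] this[of 6] this[of 7]
  have v: "v 0 = y * k 0" "v 1 = y * k 1" "v 2 = y * k 2" "v 3 = y * k 3"
    "v 4 = x * k 4" "v 5 = x * k 5" "v 6 = z * k 4" "v 7 = z * k 5"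
    by (simp_all add: eval_nat_numeral)
  have "v 4 + k 2 + k 3 = v 5 + k 0 + k 1" "v 6 + v 2 + v 3 = v 7 + v 0 + v 1" using R by blast+
  then have "int (x * k 4 + k 2 + k 3) = int (x * k 5 + k 0 + k 1)"
    "int (z * k 4 + y * k 2 + y * k 3) = int (z * k 5 + y * k 0 + y * k 1)" unfolding v by simp_all
  then have xx: "int x * (int (k 4) - int (k 5)) = int (k 0) + int (k 1) - int (k 2) - int (k 3)"
    and zz: "int z * (int (k 4) - int (k 5)) = int y * (int (k 0) + int (k 1) - int (k 2) - int (k 3))"
    by (simp_all add: algebra_simps)
  have "int z * (int (k 4) - int (k 5)) = int y * (int x * (int (k 4) - int (k 5)))"
    unfolding zz xx ..
  also have "\<dots> = int (x * y) * (int (k 4) - int (k 5))" by simp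
  finally have "int z * (int (k 4) - int (k 5)) = int (x * y) * (int (k 4) - int (k 5))" .
  moreover have "int (k 4) - int (k 5) \<noteq> 0" using R by simp
  ultimately have "int z = int (x * y)" by (simp only: mult_cancel_right) blast
  then show "z = x * y" by (simp only: of_nat_eq_iff)
next
  assume z: "z = x * y"
  obtain D where D: "D > 0" "\<And>W. \<exists>t0. \<forall>t\<ge>t0. \<exists>n\<ge>W. t \<le> prime_quotient n \<and>
     real (prime_quotient n) \<le> real t + D * sqrt (real t) \<and> nth_prime (n + W) < nth_prime n + n"
    using nth_prime_quotient_sqrt_gaps unfolding prime_quotient_def by blast
  \<comment> \<open>Bounds \<open>n0\<close> and all three multipliers, so every quotient in
    \<open>G\<close> can be multiplied by each of \<open>x\<close>, \<open>y\<close>,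
    \<open>z\<close>.\<close>
  define W where "W = n0 + x + y + z + 1"
  define G where "G = {K. \<exists>n\<ge>W. K = prime_quotient n \<and> W \<le> K \<and> nth_prime (n + W) < nth_prime n + n}"
  have "\<exists>t0. \<forall>t\<ge>t0. \<exists>K\<in>G. t \<le> K \<and> real K \<le> real t + D * sqrt (real t)"
  proof -
    obtain t0 where t0: "\<And>t. t \<ge> t0 \<Longrightarrow> \<exists>n\<ge>W. t \<le> prime_quotient n \<and>
       real (prime_quotient n) \<le> real t + D * sqrt (real t) \<and> nth_prime (n + W) < nth_prime n + n"
      using D(2)[of W] by blast
    show ?thesis
    \<comment> \<open>Raising the threshold by \<open>W\<close> makes the quotients found
      automatically at least \<open>W\<close>, as membership in \<open>G\<close> demands.\<close>
    proof (rule exI[of _ "t0 + W"], intro allI impI)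
      fix t assume t: "t0 + W \<le> t"
      then obtain n where "n \<ge> W" "t \<le> prime_quotient n"
       "real (prime_quotient n) \<le> real t + D * sqrt (real t)" "nth_prime (n + W) < nth_prime n + n"
        using t0[of t] by auto
      moreover from this t have "prime_quotient n \<in> G" unfolding G_def by auto
      ultimately show "\<exists>K\<in>G. t \<le> K \<and> real K \<le> real t + D * sqrt (real t)" by blast
    qed
  qed
  from quotient_representation[OF this, of x] obtain K1 K2 K3 K4 K5 K6 where
    KG: "K1 \<in> G" "K2 \<in> G" "K3 \<in> G" "K4 \<in> G" "K5 \<in> G" "K6 \<in> G" and
    K: "K5 \<noteq> K6" "x * K5 + K3 + K4 = x * K6 + K1 + K2" by blast
  define k where "k = (\<lambda>i. [K1, K2, K3, K4, K5, K6] ! i)"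
  define ix :: "nat list" where "ix = [0,1,2,3,4,5,4,5]"
  define ws where "ws = [y,y,y,y,x,x,z,z]"
  have wit: "\<exists>n. product_witness r0 n0 n K w (w * K)" if "K \<in> G" "w \<le> W" for K w
  proof -
    from that(1) obtain n where n: "n \<ge> W" "K = prime_quotient n" "W \<le> K" "nth_prime (n + W) < nth_prime n + n"
      by (auto simp: G_def)
    have "n0 \<le> n" "w \<le> prime_quotient n" "1 \<le> W" using n that(2) unfolding W_def by linarith+
    then have "product_witness r0 n0 n (prime_quotient n) w (w * prime_quotient n)"
      using n(4) that(2) by (intro product_witness_complete[OF n0, where W = W])
    then show ?thesis using n(2) by blast
  qed
  have "\<forall>c<8. k (ix ! c) \<in> G \<and> ws ! c \<le> W"
    using KG by (simp add: k_def ix_def ws_def W_def eval_nat_numeral less_Suc_eq)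
  then have "\<forall>c<8. \<exists>n. product_witness r0 n0 n (k (ix ! c)) (ws ! c) (ws ! c * k (ix ! c))"
    using wit by blast
  then obtain n where n: "\<And>c. c < 8 \<Longrightarrow> product_witness r0 n0 (n c) (k (ix ! c)) (ws ! c) (ws ! c * k (ix ! c))"
    by metis
  have "?R k (\<lambda>c. ws ! c * k (ix ! c)) n"
  proof (intro conjI)
    show "\<forall>c<8. product_witness r0 n0 (n c) (k ([0,1,2,3,4,5,4,5::nat] ! c)) ([y,y,y,y,x,x,z,z] ! c) (ws ! c * k (ix ! c))"
      using n unfolding ix_def ws_def by blast
    have simps: "k 0 = K1" "k 1 = K2" "k 2 = K3" "k 3 = K4" "k 4 = K5" "k 5 = K6"
      by (simp_all add: k_def eval_nat_numeral)
    have vs: "ws ! 0 * k (ix ! 0) = y * K1" "ws ! 1 * k (ix ! 1) = y * K2" "ws ! 2 * k (ix ! 2) = y * K3"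
      "ws ! 3 * k (ix ! 3) = y * K4" "ws ! 4 * k (ix ! 4) = x * K5" "ws ! 5 * k (ix ! 5) = x * K6"
      "ws ! 6 * k (ix ! 6) = z * K5" "ws ! 7 * k (ix ! 7) = z * K6"
      by (simp_all add: k_def ix_def ws_def eval_nat_numeral)
    show "k 4 \<noteq> k 5" using K simps by simp
    show "ws ! 4 * k (ix ! 4) + k 2 + k 3 = ws ! 5 * k (ix ! 5) + k 0 + k 1"
      unfolding vs simps by (rule K(2))
    have "y * (x * K5 + K3 + K4) = y * (x * K6 + K1 + K2)" using K(2) by simp
    then show "ws ! 6 * k (ix ! 6) + ws ! 2 * k (ix ! 2) + ws ! 3 * k (ix ! 3) =
      ws ! 7 * k (ix ! 7) + ws ! 0 * k (ix ! 0) + ws ! 1 * k (ix ! 1)"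
      unfolding vs z by (simp add: algebra_simps)
  qed
  then show "\<exists>k v n. ?R k v n"
    by (rule exI[of _ k, OF exI[of _ "\<lambda>c. ws ! c * k (ix ! c)", OF exI[of _ n]]])
qed

section \<open>The formula\<close>

text \<open>The induction varies \<open>e\<close> because each quantifier updates it; the witness
  for the outermost variable \<open>u\<close> is \<open>e' u\<close>.\<close>

lemma sat_foldr_Ex:
  "sat r0 e (foldr Ex us \<psi>) \<longleftrightarrow> (\<exists>e'. (\<forall>i. i \<notin> set us \<longrightarrow> e' i = e i) \<and> sat r0 e' \<psi>)"
proof (induction us arbitrary: e)
  case Nil
  have "(\<forall>i. e' i = e i) \<longleftrightarrow> e' = e" for e' by auto
  then show ?case by simp
next
  case (Cons u us)
  have "(\<exists>a. \<exists>e'. (\<forall>i. i \<notin> set us \<longrightarrow> e' i = (e(u := a)) i) \<and> sat r0 e' \<psi>) \<longleftrightarrow>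
    (\<exists>e'. (\<forall>i. i \<notin> set (u # us) \<longrightarrow> e' i = e i) \<and> sat r0 e' \<psi>)" (is "?L \<longleftrightarrow> ?R")
  proof
    assume ?L
    then obtain a e' where e': "\<forall>i. i \<notin> set us \<longrightarrow> e' i = (e(u := a)) i" "sat r0 e' \<psi>" by blast
    then show ?R by (intro exI[of _ e']) auto
  next
    assume ?R
    then obtain e' where e': "\<forall>i. i \<notin> set (u # us) \<longrightarrow> e' i = e i" "sat r0 e' \<psi>" by blast
    then show ?L by (intro exI[of _ "e' u"] exI[of _ e']) auto
  qed
  then show ?case by (simp add: Cons.IH)
qed

lemma free_vars_foldr_Ex: "free_vars (foldr Ex us \<psi>) = free_vars \<psi> - set us"
  by (induction us) auto

lemma sat_foldr_Conj: "sat r0 e (foldr Conj \<phi>s \<psi>) \<longleftrightarrow> (\<forall>\<phi>\<in>set \<phi>s. sat r0 e \<phi>) \<and> sat r0 e \<psi>"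
  by (induction \<phi>s) auto

lemma free_vars_foldr_Conj: "free_vars (foldr Conj \<phi>s \<psi>) = (\<Union>\<phi>\<in>set \<phi>s. free_vars \<phi>) \<union> free_vars \<psi>"
  by (induction \<phi>s) auto

lemma quantifier_free_foldr_Conj:
  "quantifier_free (foldr Conj \<phi>s \<psi>) \<longleftrightarrow> (\<forall>\<phi>\<in>set \<phi>s. quantifier_free \<phi>) \<and> quantifier_free \<psi>"
  by (induction \<phi>s) auto

text \<open>Variables 0, 1, 2 are the arguments; 3 and 4 hold the numbers 0 and 1 (characterised by
  \<open>o + o = o\<close> and \<open>1 + 1 = p\<^sub>0\<close>); 5 to 10 hold the six quotients, 11 to 18 the eight
  products, and each product has a block of five auxiliary variables from 19 on: the index \<open>n\<close>
  and the slack variables of four inequalities.\<close>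

fun numeral_tm :: "nat \<Rightarrow> tm" where
  "numeral_tm 0 = Var 3"
| "numeral_tm (Suc k) = Add (numeral_tm k) (Var 4)"

lemma numeral_tm_val: "e 3 = 0 \<Longrightarrow> e 4 = 1 \<Longrightarrow> tm_val r0 e (numeral_tm k) = k"
  by (induction k) auto

lemma numeral_tm_vars: "tm_vars (numeral_tm k) \<subseteq> {3, 4}"
  by (induction k) auto

definition shift_fm :: "tm \<Rightarrow> tm \<Rightarrow> tm \<Rightarrow> fm" where
  "shift_fm n w v = (let s = Add n w; 
      lhs = Add (PrimeFn s) (RemFn n); rhs = Add (Add v (PrimeFn n)) (RemFn s) in
    Disj (Eq lhs rhs) (Disj (Eq (Add lhs s) rhs) (Eq lhs (Add rhs s))))"

lemma sat_shift_fm: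
  "sat r0 e (shift_fm n w v) \<longleftrightarrow> shift_rel r0 (tm_val r0 e n) (tm_val r0 e w) (tm_val r0 e v)"
  by (simp add: shift_fm_def shift_rel_def Let_def)

text \<open>The slack \<open>d\<close>, later quantified existentially, stands in for an order
  symbol; \<open>Var 4\<close> has the value 1 and makes the inequality strict.\<close>

definition less_fm :: "tm \<Rightarrow> tm \<Rightarrow> tm \<Rightarrow> fm" where
  "less_fm d a b = Eq (Add (Add a d) (Var 4)) b"

definition product_fm :: "nat \<Rightarrow> nat \<Rightarrow> nat \<Rightarrow> nat \<Rightarrow> nat \<Rightarrow> fm" where
  "product_fm n0 b K w v =
    Conj (Eq (Add (numeral_tm n0) (Var (b + 1))) (Var b))
    (Conj (less_fm (Var (b + 2)) (Var K) (Var b))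
    (Conj (less_fm (Var (b + 3)) (Var v) (Var b))
    (Conj (Eq (Add (Var w) (Var (b + 4))) (Var K))
    (Conj (shift_fm (Var b) (Var 4) (Var K)) (shift_fm (Var b) (Var w) (Var v))))))"

lemma sat_product_fm:
  assumes "e 3 = 0" "e 4 = 1"
  shows "sat r0 e (product_fm n0 b K w v) \<longleftrightarrow>
    e b = n0 + e (b + 1) \<and> e b = e K + e (b + 2) + 1 \<and> e b = e v + e (b + 3) + 1 \<and>
    e K = e w + e (b + 4) \<and> shift_rel r0 (e b) 1 (e K) \<and> shift_rel r0 (e b) (e w) (e v)"
  using assms by (auto simp: product_fm_def less_fm_def sat_shift_fm numeral_tm_val)

lemma sat_product_fm_imp_witness:
  assumes "e 3 = 0" "e 4 = 1" "sat r0 e (product_fm n0 b K w v)"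
  shows "product_witness r0 n0 (e b) (e K) (e w) (e v)"
  using assms(3) unfolding sat_product_fm[OF assms(1,2)] product_witness_def by linarith

text \<open>The slack values are truncated differences, which are exact by the inequalities of the
  witness.\<close>

lemma witness_imp_sat_product_fm:
  assumes "e 3 = 0" "e 4 = 1" "product_witness r0 n0 (e b) (e K) (e w) (e v)"
    and "e (b + 1) = e b - n0" "e (b + 2) = e b - e K - 1" "e (b + 3) = e b - e v - 1"
    and "e (b + 4) = e K - e w"
  shows "sat r0 e (product_fm n0 b K w v)"
  using assms(3-) unfolding sat_product_fm[OF assms(1,2)] product_witness_def by linarith

definition mult_matrix :: "nat \<Rightarrow> fm" where
  "mult_matrix n0 = 
    foldr Conj (map (\<lambda>c. product_fm n0 (19 + 5 * c) (5 + [0,1,2,3,4,5,4,5] ! c) ([1,1,1,1,0,0,2,2] ! c) (11 + c)) [0..<8])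
    (Conj (Eq (Add (Var 3) (Var 3)) (Var 3))
    (Conj (Eq (Add (Var 4) (Var 4)) (PrimeFn (Var 3)))
    (Conj (Neg (Eq (Var 9) (Var 10)))
    (Conj (Eq (Add (Add (Var 15) (Var 7)) (Var 8)) (Add (Add (Var 16) (Var 5)) (Var 6)))
      (Eq (Add (Add (Var 17) (Var 13)) (Var 14)) (Add (Add (Var 18) (Var 11)) (Var 12)))))))"

text \<open>\<open>59 = 19 + 5 * 8\<close> is the first variable beyond the eight auxiliary
  blocks.\<close>

definition mult_fm :: "nat \<Rightarrow> fm" where
  "mult_fm n0 = foldr Ex [3..<59] (mult_matrix n0)"

lemma existential_mult_fm: "existential (mult_fm n0)"
  unfolding existential_def mult_fm_def
  by (intro exI[of _ "[3..<59]"] exI[of _ "mult_matrix n0"])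
    (auto simp: mult_matrix_def quantifier_free_foldr_Conj product_fm_def less_fm_def shift_fm_def Let_def)

lemma free_vars_product_fm:
  "free_vars (product_fm n0 b K w v) \<subseteq> {3, 4, b, b + 1, b + 2, b + 3, b + 4, K, w, v}"
  using numeral_tm_vars[of n0] by (auto simp: product_fm_def less_fm_def shift_fm_def Let_def)

lemma product_index_bounds:
  assumes "c < 8"
  shows "[0,1,2,3,4,5,4,5::nat] ! c \<le> 5" "[1,1,1,1,0,0,2,2::nat] ! c \<le> 2"
proof -
  have "[0,1,2,3,4,5,4,5::nat] ! c \<in> set [0,1,2,3,4,5,4,5]" "[1,1,1,1,0,0,2,2::nat] ! c \<in> set [1,1,1,1,0,0,2,2]"
    using assms by (intro nth_mem; simp)+
  then show "[0,1,2,3,4,5,4,5::nat] ! c \<le> 5" "[1,1,1,1,0,0,2,2::nat] ! c \<le> 2" by auto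
qed

lemma free_vars_mult_fm: "free_vars (mult_fm n0) \<subseteq> {0, 1, 2}"
proof -
  have "free_vars (product_fm n0 (19 + 5 * c) (5 + [0,1,2,3,4,5,4,5] ! c) ([1,1,1,1,0,0,2,2] ! c) (11 + c)) \<subseteq> {..<59}"
    if "c < 8" for c
  proof -
    note product_index_bounds[OF that]
    then have "{3, 4, 19 + 5 * c, 19 + 5 * c + 1, 19 + 5 * c + 2, 19 + 5 * c + 3, 19 + 5 * c + 4,
        5 + [0,1,2,3,4,5,4,5] ! c, [1,1,1,1,0,0,2,2] ! c, 11 + c} \<subseteq> {..<59::nat}"
      using that by simp
    with free_vars_product_fm show ?thesis by (rule order_trans)
  qed
  then have "free_vars (mult_matrix n0) \<subseteq> {..<59}"
    unfolding mult_matrix_def free_vars_foldr_Conj by (auto simp: subset_iff)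
  then have "free_vars (mult_fm n0) \<subseteq> {..<59} - {3..<59}"
    unfolding mult_fm_def free_vars_foldr_Ex set_upt by (rule Diff_mono) simp
  also have "\<dots> \<subseteq> {0, 1, 2}" by auto
  finally show ?thesis .
qed

lemma nth_prime_0: "nth_prime 0 = 2"
  unfolding nth_prime_def enumerate_0 using two_is_prime_nat prime_ge_2_nat
  by (intro Least_equality) auto

lemma sat_mult_matrix:
  "sat r0 e (mult_matrix n0) \<longleftrightarrow>
    (\<forall>c<8. sat r0 e (product_fm n0 (19 + 5 * c) (5 + [0,1,2,3,4,5,4,5] ! c) ([1,1,1,1,0,0,2,2] ! c) (11 + c))) \<and>
    e 3 = 0 \<and> e 4 = 1 \<and> e 9 \<noteq> e 10 \<and> e 15 + e 7 + e 8 = e 16 + e 5 + e 6 \<and>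
    e 17 + e 13 + e 14 = e 18 + e 11 + e 12"
proof -
  \<comment> \<open>The equation for variable 4 determines 1 only once variable 3 is known to be 0,
    as \<open>nth_prime 0 = 2\<close>.\<close>
  have "e 3 = 0 \<and> e 4 + e 4 = nth_prime (e 3) \<longleftrightarrow> e 3 = 0 \<and> e 4 = 1"
    by (auto simp: nth_prime_0)
  then show ?thesis by (auto simp: mult_matrix_def sat_foldr_Conj)
qed

text \<open>Realises the variable layout of the formula; \<open>a c i\<close> is the value of the
  auxiliary variable \<open>i\<close> in block \<open>c\<close>.\<close>

definition assignment :: "(nat \<Rightarrow> nat) \<Rightarrow> (nat \<Rightarrow> nat) \<Rightarrow> (nat \<Rightarrow> nat) \<Rightarrow> (nat \<Rightarrow> nat \<Rightarrow> nat) \<Rightarrow> nat \<Rightarrow> nat" where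
  "assignment e k v a i =
    (if i < 3 then e i else if i = 3 then 0 else if i = 4 then 1
     else if i < 11 then k (i - 5) else if i < 19 then v (i - 11)
     else if i < 59 then a ((i - 19) div 5) ((i - 19) mod 5) else e i)"

lemma assignment_outside: "i < 3 \<or> 59 \<le> i \<Longrightarrow> assignment e k v a i = e i"
  by (auto simp: assignment_def)

lemma assignment_constants: "assignment e k v a 3 = 0" "assignment e k v a 4 = 1"
  by (simp_all add: assignment_def)

lemma assignment_quotients: "i < 6 \<Longrightarrow> assignment e k v a (5 + i) = k i"
  by (simp add: assignment_def)

lemma assignment_products: "i < 8 \<Longrightarrow> assignment e k v a (11 + i) = v i"
  by (simp add: assignment_def)

lemma assignment_aux:
  assumes "c < 8" "i < 5"
  shows "assignment e k v a (19 + 5 * c + i) = a c i"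
proof -
  have "5 * c + i < 40" using assms by linarith
  moreover have "(5 * c + i) div 5 = c" using assms by (simp add: div_nat_eqI)
  moreover have "(5 * c + i) mod 5 = i" using assms by (simp add: mod_nat_eqI)
  ultimately show ?thesis by (simp add: assignment_def)
qed

text \<open>An assignment of the bound variables and a triple \<open>k\<close>, \<open>v\<close>,
  \<open>n\<close> as in \<open>mult_iff_product_witnesses\<close> carry the same information: one
  direction reads the triple off, the other fills in the slacks.\<close>

lemma sat_mult_fm:
  assumes n0: "\<And>n. n \<ge> n0 \<Longrightarrow> prime_quotient n * prime_quotient n < n"
  shows "sat3 r0 (mult_fm n0) x y z \<longleftrightarrow> z = x * y"
proof -
  define e0 :: "nat \<Rightarrow> nat" where "e0 = (\<lambda>_. 0)(0 := x, 1 := y, 2 := z)"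
  have arg: "\<forall>c<8. e ([1,1,1,1,0,0,2,2] ! c) = [y,y,y,y,x,x,z,z] ! c"
    if "e 0 = x" "e 1 = y" "e 2 = z" for e :: "nat \<Rightarrow> nat"
  proof (intro allI impI)
    fix c :: nat assume "c < 8"
    then have "e ([1,1,1,1,0,0,2,2] ! c) = map e [1,1,1,1,0,0,2,2] ! c" by (subst nth_map) simp_all
    also have "map e [1,1,1,1,0,0,2,2] = [y,y,y,y,x,x,z,z]" using that by simp
    finally show "e ([1,1,1,1,0,0,2,2] ! c) = [y,y,y,y,x,x,z,z] ! c" .
  qed
  have "sat3 r0 (mult_fm n0) x y z \<longleftrightarrow> 
      (\<exists>e. (\<forall>i. i \<notin> {3..<59} \<longrightarrow> e i = e0 i) \<and> sat r0 e (mult_matrix n0))"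
    unfolding sat3_def mult_fm_def sat_foldr_Ex set_upt e0_def ..
  also have "\<dots> \<longleftrightarrow> z = x * y"
  proof
    assume "\<exists>e. (\<forall>i. i \<notin> {3..<59} \<longrightarrow> e i = e0 i) \<and> sat r0 e (mult_matrix n0)"
    then obtain e where e: "\<forall>i. i \<notin> {3..<59} \<longrightarrow> e i = e0 i" "sat r0 e (mult_matrix n0)" by blast
    have xyz: "e 0 = x" "e 1 = y" "e 2 = z" using e(1) by (auto simp: e0_def)
    note m = e(2)[unfolded sat_mult_matrix]
    note products = m[THEN conjunct1, rule_format]
    have m': "e 3 = 0" "e 4 = 1" "e 9 \<noteq> e 10" "e 15 + e 7 + e 8 = e 16 + e 5 + e 6"
      "e 17 + e 13 + e 14 = e 18 + e 11 + e 12"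
      by (rule m[THEN conjunct2, THEN conjunct1]
        m[THEN conjunct2, THEN conjunct2, THEN conjunct1]
        m[THEN conjunct2, THEN conjunct2, THEN conjunct2, THEN conjunct1]
        m[THEN conjunct2, THEN conjunct2, THEN conjunct2, THEN conjunct2, THEN conjunct1]
        m[THEN conjunct2, THEN conjunct2, THEN conjunct2, THEN conjunct2, THEN conjunct2])+
    have witnesses: "\<forall>c<8. product_witness r0 n0 (e (19 + 5 * c)) (e (5 + [0,1,2,3,4,5,4,5] ! c)) ([y,y,y,y,x,x,z,z] ! c) (e (11 + c))"
    proof (intro allI impI)
      fix c :: nat assume c: "c < 8"
      have "product_witness r0 n0 (e (19 + 5 * c)) (e (5 + [0,1,2,3,4,5,4,5] ! c)) (e ([1,1,1,1,0,0,2,2] ! c)) (e (11 + c))"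
        by (rule sat_product_fm_imp_witness[OF m'(1,2) products[OF c]])
      then show "product_witness r0 n0 (e (19 + 5 * c)) (e (5 + [0,1,2,3,4,5,4,5] ! c)) ([y,y,y,y,x,x,z,z] ! c) (e (11 + c))"
        unfolding arg[OF xyz, rule_format, OF c] .
    qed
    have shifts: "5 + 0 = (5::nat)" "5 + 1 = (6::nat)" "5 + 2 = (7::nat)" "5 + 3 = (8::nat)" "5 + 4 = (9::nat)"
      "5 + 5 = (10::nat)" "11 + 0 = (11::nat)" "11 + 1 = (12::nat)" "11 + 2 = (13::nat)" "11 + 3 = (14::nat)"
      "11 + 4 = (15::nat)" "11 + 5 = (16::nat)" "11 + 6 = (17::nat)" "11 + 7 = (18::nat)"
      by simp_all
    have eqs: "e (5 + 4) \<noteq> e (5 + 5)" "e (11 + 4) + e (5 + 2) + e (5 + 3) = e (11 + 5) + e (5 + 0) + e (5 + 1)"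
      "e (11 + 6) + e (11 + 2) + e (11 + 3) = e (11 + 7) + e (11 + 0) + e (11 + 1)"
      unfolding shifts by (rule m')+
    show "z = x * y"
      by (rule mult_iff_product_witnesses[where ?r0.0 = r0, OF n0, THEN iffD2], assumption,
          rule exI[of _ "\<lambda>i. e (5 + i)"], rule exI[of _ "\<lambda>i. e (11 + i)"],
          rule exI[of _ "\<lambda>c. e (19 + 5 * c)"])
        (intro conjI witnesses eqs)
  next
    assume "z = x * y"
    from mult_iff_product_witnesses[where ?r0.0 = r0, OF n0, THEN iffD1, OF _ this] obtain k v n where w:
      "\<And>c. c < 8 \<Longrightarrow> product_witness r0 n0 (n c) (k ([0,1,2,3,4,5,4,5::nat] ! c)) ([y,y,y,y,x,x,z,z] ! c) (v c)" and
      eqs: "k 4 \<noteq> k 5" "v 4 + k 2 + k 3 = v 5 + k 0 + k 1" "v 6 + v 2 + v 3 = v 7 + v 0 + v 1"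
      by blast
    \<comment> \<open>Position 0 is the index of the witness, positions 1 to 4 are the slacks in the
      order of \<open>product_fm\<close>.\<close>
    define aux where "aux = (\<lambda>c (i::nat). if i = 0 then n c else if i = 1 then n c - n0
      else if i = 2 then n c - k ([0,1,2,3,4,5,4,5::nat] ! c) - 1 else if i = 3 then n c - v c - 1
      else k ([0,1,2,3,4,5,4,5::nat] ! c) - [y,y,y,y,x,x,z,z] ! c)"
    define e where "e = assignment e0 k v aux"
    have e34: "e 3 = 0" "e 4 = 1" unfolding e_def by (rule assignment_constants)+
    have outside: "e i = e0 i" if "i < 3 \<or> 59 \<le> i" for i
      unfolding e_def using that by (rule assignment_outside)
    have xyz: "e 0 = x" "e 1 = y" "e 2 = z" by (simp_all add: outside) (simp_all add: e0_def)
    note ek = assignment_quotients[of _ e0 k v aux, folded e_def]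
    note ev = assignment_products[of _ e0 k v aux, folded e_def]
    note ea = assignment_aux[of _ _ e0 k v aux, folded e_def]
    have products: "sat r0 e (product_fm n0 (19 + 5 * c) (5 + [0,1,2,3,4,5,4,5] ! c) ([1,1,1,1,0,0,2,2] ! c) (11 + c))"
      if c: "c < 8" for c
    proof (rule witness_imp_sat_product_fm[OF e34])
      have k: "e (5 + [0,1,2,3,4,5,4,5] ! c) = k ([0,1,2,3,4,5,4,5::nat] ! c)"
        by (intro ek le_less_trans[OF product_index_bounds(1)[OF c]]) simp
      have b: "e (19 + 5 * c) = n c" using ea[OF c, of 0] by (simp add: aux_def)
      note s = k b ev[OF c] arg[OF xyz, rule_format, OF c]
      show "product_witness r0 n0 (e (19 + 5 * c)) (e (5 + [0,1,2,3,4,5,4,5] ! c)) (e ([1,1,1,1,0,0,2,2] ! c)) (e (11 + c))"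
        unfolding s by (rule w[OF c])
      show "e (19 + 5 * c + 1) = e (19 + 5 * c) - n0"
        "e (19 + 5 * c + 2) = e (19 + 5 * c) - e (5 + [0,1,2,3,4,5,4,5] ! c) - 1"
        "e (19 + 5 * c + 3) = e (19 + 5 * c) - e (11 + c) - 1"
        "e (19 + 5 * c + 4) = e (5 + [0,1,2,3,4,5,4,5] ! c) - e ([1,1,1,1,0,0,2,2] ! c)"
        unfolding s by (subst ea[OF c]; simp add: aux_def)+
    qed
    have es: "e 9 = k 4" "e 10 = k 5" "e 5 = k 0" "e 6 = k 1" "e 7 = k 2" "e 8 = k 3"
      using ek[of 4] ek[of 5] ek[of 0] ek[of 1] ek[of 2] ek[of 3] by simp_all
    have es': "e 11 = v 0" "e 12 = v 1" "e 13 = v 2" "e 14 = v 3" "e 15 = v 4" "e 16 = v 5" "e 17 = v 6" "e 18 = v 7"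
      using ev[of 0] ev[of 1] ev[of 2] ev[of 3] ev[of 4] ev[of 5] ev[of 6] ev[of 7] by simp_all
    have "sat r0 e (mult_matrix n0)"
      unfolding sat_mult_matrix es es' using products e34 eqs by blast
    moreover have "\<forall>i. i \<notin> {3..<59} \<longrightarrow> e i = e0 i"
    proof (intro allI impI)
      fix i :: nat assume "i \<notin> {3..<59}"
      then have "i < 3 \<or> 59 \<le> i" unfolding atLeastLessThan_iff by linarith
      then show "e i = e0 i" by (rule outside)
    qed
    ultimately show "\<exists>e. (\<forall>i. i \<notin> {3..<59} \<longrightarrow> e i = e0 i) \<and> sat r0 e (mult_matrix n0)" by blast
  qed
  finally show ?thesis .
qed

theorem theorem1:
  fixes r0 :: nat
  shows "\<exists>\<phi>. existential \<phi> \<and> free_vars \<phi> \<subseteq> {0, 1, 2} \<and>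
    (\<forall>x y z. sat3 r0 \<phi> x y z \<longleftrightarrow> z = x * y)"
proof -
  \<comment> \<open>This threshold depends neither on the arguments nor on \<open>r0\<close>, so it
    can be written into the formula as a numeral.\<close>
  obtain n0 where "\<forall>n\<ge>n0. prime_quotient n * prime_quotient n < n"
    using prime_quotient_square_less by blast
  then have "sat3 r0 (mult_fm n0) x y z \<longleftrightarrow> z = x * y" for x y z
    by (intro sat_mult_fm) blast
  then show ?thesis using existential_mult_fm free_vars_mult_fm by blast
qed

end
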